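(* The abstract unification operator $\mathsf{unif}_{\mathrm{Sh}}$ is correct with respect to $\mathsf{unif}_{\mathrm{Ps}}$: for every $\chi\in\mathtt{Psub}$ and every $\theta\in\mathit{ISubst}$, $$\alpha_{\mathrm{Sh}}(\mathsf{unif}_{\mathrm{Ps}}(\chi,\theta))\sqsubseteq_{\mathrm{Sh}}\mathsf{unif}_{\mathrm{Sh}}(\alpha_{\mathrm{Sh}}(\chi),\theta).$$
   Context: **Substitutions.** Fix a first-order signature with at least one constant and one function symbol of arity $\ge 2$, and an infinite set $\mathcal V$ of variables; $\wp_f$ denotes finite subsets. $\mathrm{vars}(o)$ is the set of variables occurring in $o$ and $\mathrm{uvars}(o)$ the set of variables occurring exactly once in $o$. A substitution is a map $\theta$ from $\mathcal V$ to terms with finite $\mathrm{dom}(\theta)=\{x\mid\theta(x)\neq x\}$, extended to terms; $\mathrm{rng}(\theta)$ is the set of variables of the terms $\theta(x)$, $x\in\mathrm{dom}(\theta)$; $\mathrm{vars}(\theta)=\mathrm{dom}(\theta)\cup\mathrm{rng}(\theta)$. $\mathit{ISubst}$ is the set of idempotent substitutions ($\mathrm{dom}\cap\mathrm{rng}=\emptyset$); a renaming is a substitution that is a bijection $\mathcal V\to\mathcal V$; $\epsilon$ is the identity substitution. $\mathrm{mgu}(\sigma_1,\sigma_2)$ denotes an idempotent most general unifier of $\{x=\sigma_i(x)\mid i\in\{1,2\},x\in\mathrm{dom}(\sigma_i)\}$ with variables among those of these equations, if it exists. **Existential substitutions.** For $U\in\wp_f(\mathcal V)$, $\theta_1\sim_U\theta_2$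 iff there is a renaming $\rho$ with $\theta_1(u)=\rho(\theta_2(u))$ for all $u\in U$; $[\theta]_U$ is the $\sim_U$-class of $\theta\in\mathit{ISubst}$, $\mathit{ISubst}_{\sim_U}$ the set of such classes. $\mathrm{mgu}([\theta_1]_U,[\theta_2]_V)=[\mathrm{mgu}(\theta_1',\theta_2')]_{U\cup V}$ where $\theta_1\sim_U\theta_1'\in\mathit{ISubst}$, $\theta_2\sim_V\theta_2'\in\mathit{ISubst}$ and $(U\cup\mathrm{vars}(\theta_1'))\cap(V\cup\mathrm{vars}(\theta_2'))\subseteq U\cap V$ (independent of choices; undefined if not unifiable). **Domains.** $\mathtt{Psub}=\{[\Theta,U]\mid\Theta\subseteq\mathit{ISubst}_{\sim_U},U\in\wp_f(\mathcal V)\}\cup\{\bot_{\mathrm{Ps}},\top_{\mathrm{Ps}}\}$, with bottom $\bot_{\mathrm{Ps}}$, top $\top_{\mathrm{Ps}}$, and $[\Theta_1,U_1]\sqsubseteq_{\mathrm{Ps}}[\Theta_2,U_2]$ iff $U_1=U_2$, $\Theta_1\subseteq\Theta_2$. $\mathtt{Sharing}=\{[A,U]\mid A\subseteq\wp(U),(A\ne\emptyset\Rightarrow\emptyset\in A),U\in\wp_f(\mathcal V)\}\cup\{\bot_{\mathrm{Sh}},\top_{\mathrm{Sh}}\}$, ordered by $\sqsubseteq_{\mathrm{Sh}}$ in the same way. With $\mathrm{occ}(\sigma,y)=\{z\in\mathcal V\mid y\in\mathrm{vars}(\sigma(z))\}$, $\alpha_{\mathrm{Sh}}([\sigma]_V)=[\{\mathrm{occ}(\sigma,y)\cap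 V\mid y\in\mathcal V\},V]$; $\alpha_{\mathrm{Sh}}:\mathtt{Psub}\to\mathtt{Sharing}$ maps bottom to bottom, top to top, and $\alpha_{\mathrm{Sh}}([\Theta,U])=[\bigcup_{[\sigma]_U\in\Theta}A_\sigma,U]$ where $\alpha_{\mathrm{Sh}}([\sigma]_U)=[A_\sigma,U]$. **Concrete unification.** $\mathsf{unif}_{\mathrm{Ps}}([\Theta,U],\delta)=[\{\mathrm{mgu}(c,[\delta]_{\mathrm{vars}(\delta)})\mid c\in\Theta,\text{ mgu defined}\},U\cup\mathrm{vars}(\delta)]$ for $\delta\in\mathit{ISubst}$. **Abstract unification.** For $A,B\subseteq\wp_f(\mathcal V)$ and $W\subseteq\mathcal V$ finite: $A^*=\{\bigcup T\mid\emptyset\ne T\in\wp_f(A)\}$; $\mathbf{rel}(A,W)=\{T\in A\mid T\cap W\ne\emptyset\}$, with $\mathbf{rel}(A,o)=\mathbf{rel}(A,\mathrm{vars}(o))$; $\mathbf{bin}(A,B)=\{T_1\cup T_2\mid T_1\in A,T_2\in B\}$. Define $\mathbf u^f_{\mathrm{Sh}}(S,U,\theta)$ by recursion on the bindings of $\theta\in\mathit{ISubst}$, processed one at a time: $\mathbf u^f_{\mathrm{Sh}}(S,U,\epsilon)=S$; if $x\in U$, $$\mathbf u^f_{\mathrm{Sh}}(S,U,\{x/t\}\uplus\delta)=\mathbf u^f_{\mathrm{Sh}}\big((S\setminus(\mathbf{rel}(S,t)\cup\mathbf{rel}(S,x)))\cup\mathbf{bin}(\mathbf{rel}(S,x),\mathbf{rel}(S,t)),\,U\setminus\{x\},\,\delta\big);$$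 if $x\notin U$, with $Y=\mathrm{uvars}(t)\cap U$ and $Z=\mathrm{vars}(t)\setminus Y$, $$\mathbf u^f_{\mathrm{Sh}}(S,U,\{x/t\}\uplus\delta)=\mathbf u^f_{\mathrm{Sh}}\big((S\setminus(\mathbf{rel}(S,t)\cup\mathbf{rel}(S,x)))\cup\mathbf{bin}(\mathbf{rel}(S,x),\mathbf{rel}(S,Y)^* )\cup\mathbf{bin}(\mathbf{rel}(S,x)^*,\mathbf{rel}(S,Z)^* )\cup\mathbf{bin}(\mathbf{bin}(\mathbf{rel}(S,x)^*,\mathbf{rel}(S,Z)^* ),\mathbf{rel}(S,Y)^* ),\,U\setminus\mathrm{vars}(\{x/t\}),\,\delta\big).$$ Then, for every $[S_1,U_1]\in\mathtt{Sharing}$, $\mathsf{unif}_{\mathrm{Sh}}([S_1,U_1],\theta)=[\mathbf u^f_{\mathrm{Sh}}(S_1\cup\{\{x\}\mid x\in U_2\},U_2,\theta),U_1\cup U_2]$ with $U_2=\mathrm{vars}(\theta)\setminus U_1$. Both $\mathsf{unif}_{\mathrm{Ps}}$ and $\mathsf{unif}_{\mathrm{Sh}}$ map bottom to bottom and top to top. *)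

theory Defs imports Main begin

datatype ('f, vars: 'v) trm = Var 'v | Fun 'f "('f, 'v) trm list"

primrec wf_trm :: "('f \<Rightarrow> nat) \<Rightarrow> ('f, 'v) trm \<Rightarrow> bool" where
  "wf_trm ar (Var x) \<longleftrightarrow> True"
| "wf_trm ar (Fun f ts) \<longleftrightarrow> length ts = ar f \<and> list_all (wf_trm ar) ts"

primrec occurrences :: "'v \<Rightarrow> ('f, 'v) trm \<Rightarrow> nat" where
  "occurrences x (Var y) = (if x = y then 1 else 0)"
| "occurrences x (Fun f ts) = sum_list (map (occurrences x) ts)"

definition uvars :: "('f, 'v) trm \<Rightarrow> 'v set" where
  "uvars t = {x. occurrences x t = 1}"

type_synonym ('f, 'v) subst = "'v \<Rightarrow> ('f, 'v) trm"

primrec app :: "('f, 'v) subst \<Rightarrow> ('f, 'v) trm \<Rightarrow> ('f, 'v) trm" where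
  "app \<theta> (Var x) = \<theta> x"
| "app \<theta> (Fun f ts) = Fun f (map (app \<theta>) ts)"

definition sdom :: "('f, 'v) subst \<Rightarrow> 'v set" where
  "sdom \<theta> = {x. \<theta> x \<noteq> Var x}"

definition srng :: "('f, 'v) subst \<Rightarrow> 'v set" where
  "srng \<theta> = (\<Union>x\<in>sdom \<theta>. vars (\<theta> x))"

definition svars :: "('f, 'v) subst \<Rightarrow> 'v set" where
  "svars \<theta> = sdom \<theta> \<union> srng \<theta>"

definition Subst :: "('f \<Rightarrow> nat) \<Rightarrow> ('f, 'v) subst set" where
  "Subst ar = {\<theta>. finite (sdom \<theta>) \<and> (\<forall>x. wf_trm ar (\<theta> x))}"

definition ISubst :: "('f \<Rightarrow> nat) \<Rightarrow> ('f, 'v) subst set" where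
  "ISubst ar = {\<theta> \<in> Subst ar. sdom \<theta> \<inter> srng \<theta> = {}}"

definition Renaming :: "('f \<Rightarrow> nat) \<Rightarrow> ('f, 'v) subst set" where
  "Renaming ar = {\<rho> \<in> Subst ar. \<exists>\<pi>. bij \<pi> \<and> \<rho> = Var \<circ> \<pi>}"

definition equations :: "('f, 'v) subst \<Rightarrow> (('f, 'v) trm \<times> ('f, 'v) trm) set" where
  "equations \<sigma> = {(Var x, \<sigma> x) | x. x \<in> sdom \<sigma>}"

definition unifiers ::
  "('f \<Rightarrow> nat) \<Rightarrow> (('f, 'v) trm \<times> ('f, 'v) trm) set \<Rightarrow> ('f, 'v) subst set" where
  "unifiers ar E = {\<sigma> \<in> Subst ar. \<forall>(s, t)\<in>E. app \<sigma> s = app \<sigma> t}"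

definition is_mgu ::
  "('f \<Rightarrow> nat) \<Rightarrow> ('f, 'v) subst \<Rightarrow> ('f, 'v) subst \<Rightarrow> ('f, 'v) subst \<Rightarrow> bool" where
  "is_mgu ar \<sigma>\<^sub>1 \<sigma>\<^sub>2 \<mu> \<longleftrightarrow>
     (let E = equations \<sigma>\<^sub>1 \<union> equations \<sigma>\<^sub>2 in
        \<mu> \<in> ISubst ar \<and> \<mu> \<in> unifiers ar E \<and>
        (\<forall>\<tau>\<in>unifiers ar E. \<exists>\<delta>\<in>Subst ar. \<tau> = app \<delta> \<circ> \<mu>) \<and>
        svars \<mu> \<subseteq> (\<Union>(s, t)\<in>E. vars s \<union> vars t))"

definition esim :: "('f \<Rightarrow> nat) \<Rightarrow> 'v set \<Rightarrow> ('f, 'v) subst rel" where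
  "esim ar U = {(\<theta>\<^sub>1, \<theta>\<^sub>2). \<theta>\<^sub>1 \<in> ISubst ar \<and> \<theta>\<^sub>2 \<in> ISubst ar \<and>
     (\<exists>\<rho>\<in>Renaming ar. \<forall>u\<in>U. \<theta>\<^sub>1 u = app \<rho> (\<theta>\<^sub>2 u))}"

definition ecls :: "('f \<Rightarrow> nat) \<Rightarrow> 'v set \<Rightarrow> ('f, 'v) subst \<Rightarrow> ('f, 'v) subst set" where
  "ecls ar U \<theta> = esim ar U `` {\<theta>}"

text \<open>
  The mgu of existential substitutions is defined through a choice of representatives and of an
  mgu of these, and does not depend on that choice. It is therefore given as the relation
  ``\<open>e\<close> is the mgu of \<open>c\<close> and \<open>d\<close>'', which admits every choice; \<open>U\<close> and \<open>V\<close> are the sets of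
  variables of interest of \<open>c\<close> and \<open>d\<close>, and the mgu is undefined iff no \<open>e\<close> is related.
\<close>

definition is_emgu ::
  "('f \<Rightarrow> nat) \<Rightarrow> 'v set \<Rightarrow> ('f, 'v) subst set \<Rightarrow> 'v set \<Rightarrow> ('f, 'v) subst set
     \<Rightarrow> ('f, 'v) subst set \<Rightarrow> bool" where
  "is_emgu ar U c V d e \<longleftrightarrow>
     (\<exists>\<theta>\<^sub>1\<in>c. \<exists>\<theta>\<^sub>2\<in>d. \<exists>\<mu>. (U \<union> svars \<theta>\<^sub>1) \<inter> (V \<union> svars \<theta>\<^sub>2) \<subseteq> U \<inter> V \<and>
        is_mgu ar \<theta>\<^sub>1 \<theta>\<^sub>2 \<mu> \<and> e = ecls ar (U \<union> V) \<mu>)"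

text \<open>Common shape of the concrete and of the abstract domain; \<open>Elt A U\<close> stands for \<open>[A, U]\<close>.\<close>

datatype ('a, 'v) dom = Bot | Elt "'a set" "'v set" | Top

fun le_dom :: "('a, 'v) dom \<Rightarrow> ('a, 'v) dom \<Rightarrow> bool"  (infix \<open>\<sqsubseteq>\<close> 50) where
  "Bot \<sqsubseteq> \<xi> \<longleftrightarrow> True"
| "\<xi> \<sqsubseteq> Top \<longleftrightarrow> True"
| "Elt A U \<sqsubseteq> Elt B V \<longleftrightarrow> U = V \<and> A \<subseteq> B"
| "\<xi> \<sqsubseteq> \<zeta> \<longleftrightarrow> False"

definition Psub :: "('f \<Rightarrow> nat) \<Rightarrow> (('f, 'v) subst set, 'v) dom set" where
  "Psub ar = {Elt \<Theta> U | \<Theta> U. finite U \<and> \<Theta> \<subseteq> ISubst ar // esim ar U} \<union> {Bot, Top}"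

definition Sharing :: "('v set, 'v) dom set" where
  "Sharing = {Elt A U | A U. finite U \<and> A \<subseteq> Pow U \<and> (A \<noteq> {} \<longrightarrow> {} \<in> A)} \<union> {Bot, Top}"

definition occ :: "('f, 'v) subst \<Rightarrow> 'v \<Rightarrow> 'v set" where
  "occ \<sigma> y = {z. y \<in> vars (\<sigma> z)}"

definition sharing_groups :: "('f, 'v) subst \<Rightarrow> 'v set \<Rightarrow> 'v set set" where
  "sharing_groups \<sigma> V = {occ \<sigma> y \<inter> V | y. True}"

fun alpha_Sh :: "('f \<Rightarrow> nat) \<Rightarrow> (('f, 'v) subst set, 'v) dom \<Rightarrow> ('v set, 'v) dom" where
  "alpha_Sh ar Bot = Bot"
| "alpha_Sh ar (Elt \<Theta> U) =
     Elt (\<Union>\<sigma>\<in>{\<sigma> \<in> ISubst ar. ecls ar U \<sigma> \<in> \<Theta>}. sharing_groups \<sigma> U) U"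
| "alpha_Sh ar Top = Top"

fun unif_Ps :: "('f \<Rightarrow> nat) \<Rightarrow> (('f, 'v) subst set, 'v) dom \<Rightarrow> ('f, 'v) subst
     \<Rightarrow> (('f, 'v) subst set, 'v) dom" where
  "unif_Ps ar Bot \<delta> = Bot"
| "unif_Ps ar (Elt \<Theta> U) \<delta> =
     Elt {e. \<exists>c\<in>\<Theta>. is_emgu ar U c (svars \<delta>) (ecls ar (svars \<delta>) \<delta>) e} (U \<union> svars \<delta>)"
| "unif_Ps ar Top \<delta> = Top"

definition star :: "'v set set \<Rightarrow> 'v set set" where
  "star A = {\<Union>T | T. T \<noteq> {} \<and> finite T \<and> T \<subseteq> A}"

definition rel :: "'v set set \<Rightarrow> 'v set \<Rightarrow> 'v set set" where
  "rel A W = {T \<in> A. T \<inter> W \<noteq> {}}"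

definition bin :: "'v set set \<Rightarrow> 'v set set \<Rightarrow> 'v set set" where
  "bin A B = {T\<^sub>1 \<union> T\<^sub>2 | T\<^sub>1 T\<^sub>2. T\<^sub>1 \<in> A \<and> T\<^sub>2 \<in> B}"

text \<open>
  The recursion on the bindings of a substitution leaves the order of processing open, so the
  operator works on a list that enumerates the bindings; every enumeration is allowed.
\<close>

definition binding_lists :: "('f, 'v) subst \<Rightarrow> ('v \<times> ('f, 'v) trm) list set" where
  "binding_lists \<theta> = {bs. distinct bs \<and> set bs = {(x, \<theta> x) | x. x \<in> sdom \<theta>}}"

fun u_Sh :: "'v set set \<Rightarrow> 'v set \<Rightarrow> ('v \<times> ('f, 'v) trm) list \<Rightarrow> 'v set set" where
  "u_Sh S U [] = S"
| "u_Sh S U ((x, t) # \<delta>) =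
     (if x \<in> U then
        u_Sh ((S - (rel S (vars t) \<union> rel S {x})) \<union> bin (rel S {x}) (rel S (vars t)))
          (U - {x}) \<delta>
      else
        (let Y = uvars t \<inter> U; Z = vars t - Y in
         u_Sh ((S - (rel S (vars t) \<union> rel S {x}))
             \<union> bin (rel S {x}) (star (rel S Y))
             \<union> bin (star (rel S {x})) (star (rel S Z))
             \<union> bin (bin (star (rel S {x})) (star (rel S Z))) (star (rel S Y)))
           (U - ({x} \<union> vars t)) \<delta>))"

fun unif_Sh :: "('v set, 'v) dom \<Rightarrow> ('f, 'v) subst \<Rightarrow> ('v \<times> ('f, 'v) trm) list
     \<Rightarrow> ('v set, 'v) dom" where
  "unif_Sh Bot \<theta> bs = Bot"
| "unif_Sh (Elt S\<^sub>1 U\<^sub>1) \<theta> bs =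
     (let U\<^sub>2 = svars \<theta> - U\<^sub>1 in
      Elt (u_Sh (S\<^sub>1 \<union> {{x} | x. x \<in> U\<^sub>2}) U\<^sub>2 bs) (U\<^sub>1 \<union> U\<^sub>2))"
| "unif_Sh Top \<theta> bs = Top"

lemma binding_lists_nonempty:
  assumes "\<theta> \<in> ISubst ar"
  shows "binding_lists \<theta> \<noteq> {}"
proof -
  have "finite {(x, \<theta> x) | x. x \<in> sdom \<theta>}"
    using assms by (simp add: ISubst_def Subst_def)
  then show ?thesis
    using finite_distinct_list by (fastforce simp: binding_lists_def)
qed

lemma finite_vars: "finite (vars t)"
  by (induction t) auto

lemma alpha_Sh_in_Sharing:
  fixes \<chi> :: "(('f, 'v) subst set, 'v) dom"
  assumes "infinite (UNIV :: 'v set)" and "\<chi> \<in> Psub ar"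
  shows "alpha_Sh ar \<chi> \<in> Sharing"
proof (cases \<chi>)
  case (Elt \<Theta> U)
  then have U: "finite U"
    using assms by (auto simp: Psub_def)
  have "{} \<in> sharing_groups \<sigma> U" for \<sigma> :: "('f, 'v) subst"
  proof -
    have "finite (\<Union>u\<in>U. vars (\<sigma> u))"
      using U by (simp add: finite_vars)
    then obtain y where "y \<notin> (\<Union>u\<in>U. vars (\<sigma> u))"
      using assms(1) ex_new_if_finite by blast
    then have "occ \<sigma> y \<inter> U = {}"
      by (auto simp: occ_def)
    then show ?thesis
      unfolding sharing_groups_def by blast
  qed
  then show ?thesis
    using Elt U by (auto simp: Sharing_def sharing_groups_def)
qed (auto simp: Sharing_def)

end

theory Submission imports Defs begin

text \<open>
  The bindings \<open>x/t\<close> of \<open>\<theta>\<close> are solved one after the other: a substitution \<open>\<sigma>\<close> is replaced by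
  \<open>\<mu> \<circ> \<sigma>\<close>, where \<open>\<mu>\<close> is an mgu of \<open>\<sigma> x\<close> and \<open>\<sigma> t\<close>. The sharing group of \<open>y\<close> under \<open>\<mu> \<circ> \<sigma>\<close> is the
  union of the sharing groups under \<open>\<sigma>\<close> of the variables whose value under \<open>\<mu>\<close> contains \<open>y\<close>, and
  this union has the shape computed by the abstract operator. The only delicate point is that one
  group of \<open>rel S {x}\<close> suffices when all variables of \<open>t\<close> involved are unbound and occur once in \<open>t\<close>.
\<close>

subsection \<open>Substitutions and unification\<close>

lemma app_Var [simp]: "app Var t = t"
  by (induction t) (auto simp: map_idI)

lemma app_app: "app a (app b t) = app (\<lambda>z. app a (b z)) t"
  by (induction t) auto

lemma app_eq_iff: "app a t = app b t \<longleftrightarrow> (\<forall>z\<in>vars t. a z = b z)"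
  by (induction t) auto

lemma app_cong: "(\<And>z. z \<in> vars t \<Longrightarrow> a z = b z) \<Longrightarrow> app a t = app b t"
  by (simp add: app_eq_iff)

lemma app_ident: "(\<And>z. z \<in> vars t \<Longrightarrow> a z = Var z) \<Longrightarrow> app a t = t"
  using app_eq_iff[of a t Var] by simp

lemma vars_app: "vars (app a t) = (\<Union>z\<in>vars t. vars (a z))"
  by (induction t) auto

lemma wf_app: "wf_trm ar t \<Longrightarrow> (\<And>z. wf_trm ar (a z)) \<Longrightarrow> wf_trm ar (app a t)"
  by (induction t) (auto simp: list_all_iff)

lemma svars_subset_iff:
  "svars \<sigma> \<subseteq> X \<longleftrightarrow> (\<forall>z. \<sigma> z \<noteq> Var z \<longrightarrow> z \<in> X \<and> vars (\<sigma> z) \<subseteq> X)"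
  by (auto simp: svars_def sdom_def srng_def)

lemma notin_svars: "z \<notin> svars \<sigma> \<Longrightarrow> \<sigma> z = Var z"
  by (auto simp: svars_def sdom_def)

lemma notin_svars_range: "y \<notin> svars \<sigma> \<Longrightarrow> y \<in> vars (\<sigma> z) \<Longrightarrow> z = y"
  by (cases "\<sigma> z = Var z") (auto simp: svars_def sdom_def srng_def)

lemma svars_comp: "svars (\<lambda>z. app a (b z)) \<subseteq> svars a \<union> svars b"
  unfolding svars_subset_iff
proof (intro allI impI)
  fix z assume *: "app a (b z) \<noteq> Var z"
  have a: "vars (a v) \<subseteq> insert v (svars a)" for v
    using notin_svars_range[of _ a v] by blast
  show "z \<in> svars a \<union> svars b \<and> vars (app a (b z)) \<subseteq> svars a \<union> svars b"
  proof (cases "b z = Var z")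
    case True
    then show ?thesis using * a[of z] by (auto simp: svars_def sdom_def)
  next
    case False
    then have "z \<in> svars b" "vars (b z) \<subseteq> svars b"
      by (auto simp: svars_def sdom_def srng_def)
    then show ?thesis using a by (fastforce simp: vars_app)
  qed
qed

lemma Subst_comp:
  assumes "a \<in> Subst ar" "b \<in> Subst ar"
  shows "(\<lambda>z. app a (b z)) \<in> Subst ar"
proof -
  have "sdom (\<lambda>z. app a (b z)) \<subseteq> sdom a \<union> sdom b"
    by (auto simp: sdom_def)
  then show ?thesis
    using assms by (auto simp: Subst_def intro: wf_app finite_subset)
qed

lemma Subst_upd:
  assumes "\<sigma> \<in> Subst ar" "wf_trm ar t"
  shows "\<sigma>(x := t) \<in> Subst ar"
proof -
  have "sdom (\<sigma>(x := t)) \<subseteq> insert x (sdom \<sigma>)"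
    by (auto simp: sdom_def)
  then show ?thesis
    using assms finite_subset by (fastforce simp: Subst_def)
qed

lemma Var_in_Subst: "Var \<in> Subst ar"
  by (auto simp: Subst_def sdom_def)

section \<open>Solving equations as absorption\<close>

text \<open>With the bindings of \<open>\<sigma>\<close> read as equations, this says that
  \<open>\<tau>\<close> solves them. For an mgu \<open>\<sigma>\<close> it expresses generality with
  the unifier \<open>\<tau>\<close> itself as the factor; idempotence is the case
  \<open>\<tau> = \<sigma>\<close>.\<close>

definition absorbs :: "('f, 'v) subst \<Rightarrow> ('f, 'v) subst \<Rightarrow> bool" where
  "absorbs \<tau> \<sigma> \<longleftrightarrow> (\<forall>z. app \<tau> (\<sigma> z) = \<tau> z)"

lemma absorbs_app: "absorbs \<tau> \<sigma> \<Longrightarrow> app \<tau> (app \<sigma> t) = app \<tau> t"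
  by (simp add: app_app absorbs_def)

lemma absorbs_comp: "absorbs \<tau> a \<Longrightarrow> absorbs \<tau> b \<Longrightarrow> absorbs \<tau> (\<lambda>z. app a (b z))"
  by (simp add: absorbs_def absorbs_app)

lemma absorbs_upd: "absorbs \<tau> (Var(x := t)) \<longleftrightarrow> \<tau> x = app \<tau> t"
  by (auto simp: absorbs_def)

lemma absorbs_cong:
  assumes "absorbs a \<sigma>" "\<And>z. z \<in> svars \<sigma> \<Longrightarrow> a z = b z"
  shows "absorbs b \<sigma>"
  unfolding absorbs_def
proof
  fix z show "app b (\<sigma> z) = b z"
  proof (cases "\<sigma> z = Var z")
    case False
    then have "z \<in> svars \<sigma>" "vars (\<sigma> z) \<subseteq> svars \<sigma>"
      by (auto simp: svars_def sdom_def srng_def)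
    then have "app a (\<sigma> z) = app b (\<sigma> z)" "a z = b z"
      using assms(2) by (auto intro: app_cong)
    then show ?thesis using assms(1) by (simp add: absorbs_def)
  qed simp
qed

text \<open>Unbound variables satisfy the absorption equation trivially, so restricting it to
  \<open>sdom \<sigma>\<close> loses nothing.\<close>

lemma unifiers_equations: "(\<forall>(s, t)\<in>equations \<sigma>. app \<tau> s = app \<tau> t) \<longleftrightarrow> absorbs \<tau> \<sigma>"
proof -
  have "(\<forall>(s, t)\<in>equations \<sigma>. app \<tau> s = app \<tau> t) \<longleftrightarrow> (\<forall>x\<in>sdom \<sigma>. \<tau> x = app \<tau> (\<sigma> x))"
    by (force simp: equations_def)
  moreover have "app \<tau> (\<sigma> x) = \<tau> x" if "x \<notin> sdom \<sigma>" for x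
    using that by (simp add: sdom_def)
  ultimately show ?thesis
    unfolding absorbs_def by metis
qed

lemma ISubst_absorbs:
  assumes "\<theta> \<in> ISubst ar" shows "absorbs \<theta> \<theta>"
  unfolding absorbs_def
proof
  fix z show "app \<theta> (\<theta> z) = \<theta> z"
    using assms by (cases "\<theta> z = Var z") (force simp: ISubst_def sdom_def srng_def intro: app_ident)+
qed

section \<open>Existence of most general unifiers\<close>

lemma size_app_le: "x \<in> vars t \<Longrightarrow> size (\<tau> x) \<le> size (app \<tau> t)"
proof (induction t)
  case (Fun f ts)
  then obtain t where t: "t \<in> set ts" "x \<in> vars t" by auto
  then have "size (\<tau> x) \<le> size (app \<tau> t)" using Fun.IH by blast
  also have "\<dots> \<le> size_list size (map (app \<tau>) ts)"
    using t(1) by (intro size_list_estimation') auto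
  finally show ?case by simp
qed simp

text \<open>This is the occurs check: a common value of \<open>x\<close> and a different term
  containing \<open>x\<close> would have to be smaller than itself.\<close>

lemma size_app_less:
  assumes "x \<in> vars t" "t \<noteq> Var x"
  shows "size (\<tau> x) < size (app \<tau> t)"
proof (cases t)
  case (Fun f ts)
  then obtain r where r: "r \<in> set ts" "x \<in> vars r" using assms by auto
  have "size (\<tau> x) \<le> size (app \<tau> r)" using r(2) by (rule size_app_le)
  also have "\<dots> \<le> size_list size (map (app \<tau>) ts)"
    using r(1) by (intro size_list_estimation') auto
  finally show ?thesis using Fun by simp
qed (use assms in auto)

text \<open>Unification by deletion, variable elimination and decomposition. The assumed unifier
  \<open>\<tau>\<close> rules out clashes and cyclic equations, so only the successful cases arise.
  The measure is lexicographic: first the number of variables, then the total weight of the left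
  sides, where \<open>Suc\<close> gives every equation a positive weight.\<close>

lemma mgu_exists:
  assumes "\<forall>(s, t)\<in>set E. app \<tau> s = app \<tau> t" "\<forall>(s, t)\<in>set E. wf_trm ar s \<and> wf_trm ar t"
  shows "\<exists>\<mu>\<in>Subst ar. svars \<mu> \<subseteq> (\<Union>(s, t)\<in>set E. vars s \<union> vars t) \<and>
    (\<forall>(s, t)\<in>set E. app \<mu> s = app \<mu> t) \<and>
    (\<forall>\<tau>. (\<forall>(s, t)\<in>set E. app \<tau> s = app \<tau> t) \<longrightarrow> absorbs \<tau> \<mu>)"
  using assms
proof (induction E rule: wf_induct[OF wf_measures[of
      "[\<lambda>E. card (\<Union>(s, t)\<in>set E. vars s \<union> vars t), \<lambda>E. \<Sum>(s, t)\<leftarrow>E. Suc (size s)]"]])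
  case (1 E)
  let ?V = "\<lambda>E :: (('a, 'b) trm \<times> ('a, 'b) trm) list. \<Union>(s, t)\<in>set E. vars s \<union> vars t"
  have fin: "finite (?V E)" for E
    by (auto simp: finite_vars)
  note IH = "1.IH"[THEN spec, THEN mp, THEN mp, THEN mp]
  show ?case
  proof (cases E)
    case Nil
    have "absorbs \<tau> Var" for \<tau> :: "('a, 'b) subst" by (simp add: absorbs_def)
    then show ?thesis using Nil by (intro bexI[of _ Var]) (auto simp: svars_def sdom_def srng_def Var_in_Subst)
  next
    case (Cons e E')
    obtain s t where e: "e = (s, t)" by force
    have st: "app \<tau> s = app \<tau> t" "wf_trm ar s" "wf_trm ar t"
      and E': "\<forall>(s, t)\<in>set E'. app \<tau> s = app \<tau> t" "\<forall>(s, t)\<in>set E'. wf_trm ar s \<and> wf_trm ar t"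
      using "1.prems" Cons e by auto
    have sub: "?V E' \<subseteq> ?V E" using Cons by auto
    show ?thesis
    proof (cases "s = t")
      case True
      have "card (?V E') \<le> card (?V E)" using sub fin by (rule card_mono[rotated])
      then have "(E', E) \<in> measures [\<lambda>E. card (?V E), \<lambda>E. \<Sum>(s, t)\<leftarrow>E. Suc (size s)]"
        using Cons e by auto
      from IH[OF this E'] obtain \<mu> where \<mu>: "\<mu> \<in> Subst ar" "svars \<mu> \<subseteq> ?V E'"
          "\<forall>(s, t)\<in>set E'. app \<mu> s = app \<mu> t"
          "\<forall>\<tau>. (\<forall>(s, t)\<in>set E'. app \<tau> s = app \<tau> t) \<longrightarrow> absorbs \<tau> \<mu>"
        by blast
      have "set E = insert (t, t) (set E')"
        using Cons e True by simp
      then show ?thesis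
        using \<mu> sub by (intro bexI[of _ \<mu>]) (simp_all, blast)
    next
      case neq: False
      show ?thesis
      proof (cases "\<exists>x u. (s, t) = (Var x, u) \<or> (s, t) = (u, Var x)")
        case True
        then obtain x u where xu: "(s, t) = (Var x, u) \<or> (s, t) = (u, Var x)" by blast
        then have \<tau>: "\<tau> x = app \<tau> u" and u: "wf_trm ar u" "u \<noteq> Var x" using st neq by auto
        have "x \<notin> vars u"
          using size_app_less[of x u \<tau>] u \<tau> by auto
        \<comment> \<open>Variable elimination: replacing \<open>x\<close> by \<open>u\<close> in
          the other equations removes \<open>x\<close> altogether, so the variable count drops even
          if terms grow.\<close>
        define \<rho> where "\<rho> = Var(x := u)"
        define E'' where "E'' = map (\<lambda>(s, t). (app \<rho> s, app \<rho> t)) E'"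
        have \<rho>: "vars (app \<rho> r) \<subseteq> (vars r \<union> vars u) - {x}" for r
          using \<open>x \<notin> vars u\<close> by (auto simp: vars_app \<rho>_def split: if_splits)
        have E''V: "?V E'' \<subseteq> (?V E' \<union> vars u) - {x}"
        proof
          fix y assume "y \<in> ?V E''"
          then obtain s t where "(s, t) \<in> set E'" "y \<in> vars (app \<rho> s) \<union> vars (app \<rho> t)"
            unfolding E''_def by auto
          then show "y \<in> (?V E' \<union> vars u) - {x}"
            using \<rho>[of s] \<rho>[of t] by blast
        qed
        moreover have inV: "x \<in> ?V E" "vars u \<subseteq> ?V E" using Cons e xu by auto
        ultimately have V'': "?V E'' \<subset> ?V E" using sub by blast
        then have "(E'', E) \<in> measures [\<lambda>E. card (?V E), \<lambda>E. \<Sum>(s, t)\<leftarrow>E. Suc (size s)]"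
          using psubset_card_mono[OF fin] by auto
        note IH = IH[OF this]
        have "\<rho> \<in> Subst ar" unfolding \<rho>_def by (intro Subst_upd Var_in_Subst u)
        \<comment> \<open>The equation between \<open>x\<close> and \<open>u\<close> amounts to
          absorbing \<open>\<rho>\<close>, and a substitution that absorbs \<open>\<rho>\<close>
          cannot distinguish \<open>E'\<close> from its image \<open>E''\<close>.\<close>
        have unif: "(\<forall>(s, t)\<in>set E. app \<upsilon> s = app \<upsilon> t) \<longleftrightarrow>
            absorbs \<upsilon> \<rho> \<and> (\<forall>(s, t)\<in>set E''. app \<upsilon> s = app \<upsilon> t)" for \<upsilon>
        proof -
          have "(\<forall>(s, t)\<in>set E. app \<upsilon> s = app \<upsilon> t) \<longleftrightarrow>
              absorbs \<upsilon> \<rho> \<and> (\<forall>(s, t)\<in>set E'. app \<upsilon> s = app \<upsilon> t)"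
            using xu Cons e by (auto simp: \<rho>_def absorbs_upd)
          then show ?thesis by (auto simp: E''_def absorbs_app)
        qed
        have "\<forall>(s, t)\<in>set E''. app \<tau> s = app \<tau> t" using "1.prems" unif by blast
        moreover have "\<forall>(s, t)\<in>set E''. wf_trm ar s \<and> wf_trm ar t"
          using E'(2) \<open>\<rho> \<in> Subst ar\<close> by (auto simp: E''_def Subst_def intro!: wf_app)
        ultimately obtain \<mu> where \<mu>: "\<mu> \<in> Subst ar" "svars \<mu> \<subseteq> ?V E''"
          "\<forall>(s, t)\<in>set E''. app \<mu> s = app \<mu> t"
          "\<forall>\<tau>. (\<forall>(s, t)\<in>set E''. app \<tau> s = app \<tau> t) \<longrightarrow> absorbs \<tau> \<mu>"
          using IH by blast
        have \<rho>\<rho>: "absorbs \<rho> \<rho>"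
          using \<open>x \<notin> vars u\<close> by (auto simp: \<rho>_def absorbs_upd intro!: app_ident[symmetric])
        show ?thesis
        proof (intro bexI conjI allI impI)
          show "(\<lambda>z. app \<mu> (\<rho> z)) \<in> Subst ar" by (intro Subst_comp) fact+
          have "svars \<rho> \<subseteq> insert x (vars u)"
            by (auto simp: svars_subset_iff \<rho>_def)
          then have "svars \<rho> \<subseteq> ?V E" using inV by (meson insert_subset order_trans)
          moreover have "svars \<mu> \<subseteq> ?V E"
            using \<mu>(2) V'' by (meson order_trans psubset_imp_subset)
          ultimately show "svars (\<lambda>z. app \<mu> (\<rho> z)) \<subseteq> ?V E"
            by (intro order_trans[OF svars_comp] Un_least)
          \<comment> \<open>As \<open>\<rho>\<close> is idempotent, the composite acts on images of
            \<open>\<rho>\<close> like \<open>\<mu>\<close> alone; hence it solves both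
            \<open>\<rho>\<close> and \<open>E''\<close>.\<close>
          have "absorbs (\<lambda>z. app \<mu> (\<rho> z)) \<rho>"
            using \<rho>\<rho> by (simp add: absorbs_def flip: app_app)
          moreover have "app (\<lambda>z. app \<mu> (\<rho> z)) (app \<rho> r) = app \<mu> (app \<rho> r)" for r
            using \<rho>\<rho> by (simp add: absorbs_app flip: app_app)
          then have "\<forall>(s, t)\<in>set E''. app (\<lambda>z. app \<mu> (\<rho> z)) s = app (\<lambda>z. app \<mu> (\<rho> z)) t"
            using \<mu>(3) by (auto simp: E''_def)
          ultimately show "\<forall>(s, t)\<in>set E. app (\<lambda>z. app \<mu> (\<rho> z)) s = app (\<lambda>z. app \<mu> (\<rho> z)) t"
            using unif by blast
          show "absorbs \<upsilon> (\<lambda>z. app \<mu> (\<rho> z))" if "\<forall>(s, t)\<in>set E. app \<upsilon> s = app \<upsilon> t" for \<upsilon>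
            using that \<mu>(4) unif by (blast intro: absorbs_comp)
        qed
      next
        case False
        \<comment> \<open>Decomposition: pairing the arguments keeps the variables and strips the
          head from the left weight.\<close>
        then obtain f ss g ts where fg: "s = Fun f ss" "t = Fun g ts"
          by (cases s; cases t) auto
        have len: "length ss = length ts" "f = g"
          using st(1) fg by (auto dest: map_eq_imp_length_eq)
        have dec: "(\<forall>(s, t)\<in>set (zip ss ts). app \<upsilon> s = app \<upsilon> t) \<longleftrightarrow> app \<upsilon> s = app \<upsilon> t" for \<upsilon>
          using len(1) unfolding fg len(2) by (induction rule: list_induct2) auto
        have "(\<Union>(s, t)\<in>set (zip ss ts). vars s \<union> vars t) = vars s \<union> vars t"
          using len(1) unfolding fg len(2) by (induction rule: list_induct2) auto
        then have V: "?V (zip ss ts @ E') = ?V E" using Cons e by auto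
        have "(\<Sum>(s, t)\<leftarrow>zip ss ts. Suc (size s)) = size_list size ss"
          using len(1) by (induction rule: list_induct2) auto
        then have "(zip ss ts @ E', E) \<in> measures [\<lambda>E. card (?V E), \<lambda>E. \<Sum>(s, t)\<leftarrow>E. Suc (size s)]"
          unfolding measures_def inv_image_def by (simp add: V del: set_append) (use Cons e fg in auto)
        note IH = IH[OF this]
        have "\<forall>(s, t)\<in>set (zip ss ts). wf_trm ar s \<and> wf_trm ar t"
          using st(2,3) fg by (auto simp: list_all_iff dest: set_zip_leftD set_zip_rightD)
        moreover have unif: "(\<forall>(s, t)\<in>set E. app \<upsilon> s = app \<upsilon> t) \<longleftrightarrow>
            (\<forall>(s, t)\<in>set (zip ss ts @ E'). app \<upsilon> s = app \<upsilon> t)" for \<upsilon>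
          using dec Cons e by (simp add: ball_Un)
        ultimately show ?thesis
          using IH "1.prems" E'(2) unfolding unif V by (auto simp: ball_Un)
      qed
    qed
  qed
qed

section \<open>Matching against terms that are linear in some variables\<close>

lemma occurrences_eq_0_iff: "occurrences x t = 0 \<longleftrightarrow> x \<notin> vars t"
  by (induction t) auto

lemma match_linear:
  assumes \<kappa>: "\<kappa> = Var(y' := Var y)"
    and "app \<kappa> q = app a t"
    and "\<And>u. u \<in> Y \<Longrightarrow> occurrences u t \<le> 1"
    and "\<And>z. z \<in> vars t - Y \<Longrightarrow> y \<notin> vars (a z)"
  shows "\<exists>b. app b t = q \<and> (\<forall>z. z \<notin> Y \<longrightarrow> b z = a z)"
  using assms(2-)
proof (induction t arbitrary: q)
  case (Var z)
  show ?case
  proof (cases "z \<in> Y")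
    case True
    then show ?thesis by (intro exI[of _ "a(z := q)"]) auto
  next
    case False
    note eq = Var.prems(1)[unfolded app.simps]
    \<comment> \<open>An occurrence of \<open>y'\<close> in \<open>q\<close> would show up as
      \<open>y\<close> after \<open>\<kappa>\<close>.\<close>
    have "y \<notin> vars (app \<kappa> q)" unfolding eq using Var.prems(3) False by simp
    then have "y' \<notin> vars q" by (auto simp: \<kappa> vars_app)
    then have "app \<kappa> q = q" by (intro app_ident) (auto simp: \<kappa>)
    then show ?thesis using eq by (intro exI[of _ a]) auto
  qed
next
  case (Fun f ts)
  obtain qs where qs: "q = Fun f qs" "map (app \<kappa>) qs = map (app a) ts"
  proof (cases q)
    case (Var v)
    then show thesis using Fun.prems(1) by (cases "v = y'") (auto simp: \<kappa>)
  next
    case (Fun g qs)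
    then show thesis using that Fun.prems(1) by simp
  qed
  have "\<exists>b. map (app b) ts = qs \<and> (\<forall>z. z \<notin> Y \<longrightarrow> b z = a z)"
    using Fun.IH Fun.prems(2,3) qs(2)
  proof (induction ts arbitrary: qs)
    case Nil
    then show ?case by (intro exI[of _ a]) auto
  next
    case (Cons t ts)
    obtain p ps where qs: "qs = p # ps" "app \<kappa> p = app a t"
      "map (app \<kappa>) ps = map (app a) ts"
      using Cons.prems(4) by auto
    have occ: "occurrences u t + sum_list (map (occurrences u) ts) \<le> 1" if "u \<in> Y" for u
      using Cons.prems(2)[OF that] by simp
    have "\<exists>b. app b t = p \<and> (\<forall>z. z \<notin> Y \<longrightarrow> b z = a z)"
      using occ Cons.prems(3) qs(2) by (intro Cons.prems(1)) (auto intro: add_leD1)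
    then obtain b where b: "app b t = p" "\<And>z. z \<notin> Y \<Longrightarrow> b z = a z" by blast
    have "\<exists>b. map (app b) ts = ps \<and> (\<forall>z. z \<notin> Y \<longrightarrow> b z = a z)"
    proof (rule Cons.IH)
      show "occurrences u (Fun f ts) \<le> 1" if "u \<in> Y" for u
        using occ[OF that] by simp
      show "y \<notin> vars (a z)" if "z \<in> vars (Fun f ts) - Y" for z
        using Cons.prems(3) that by auto
    qed (use Cons.prems(1) qs in auto)
    then obtain c where c: "map (app c) ts = ps" "\<And>z. z \<notin> Y \<Longrightarrow> c z = a z" by blast
    \<comment> \<open>The matchers for the first argument and for the others agree outside
      \<open>Y\<close>, and a variable of \<open>Y\<close> cannot occur on both sides, so they can
      be glued.\<close>
    define d where "d z = (if z \<in> vars t then b z else c z)" for z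
    have "app d t = p" unfolding b(1)[symmetric] by (rule app_cong) (simp add: d_def)
    moreover have "app d r = app c r" if r: "r \<in> set ts" for r
    proof (rule app_cong)
      fix z assume z: "z \<in> vars r"
      show "d z = c z"
      proof (cases "z \<in> vars t \<and> z \<in> Y")
        case True
        then have "occurrences z t \<noteq> 0" "occurrences z r \<noteq> 0"
          using z by (auto simp: occurrences_eq_0_iff)
        moreover have "occurrences z r \<le> sum_list (map (occurrences z) ts)"
          using r by (intro member_le_sum_list) auto
        ultimately show ?thesis using occ[of z] True by auto
      qed (auto simp: d_def b c)
    qed
    ultimately have "map (app d) (t # ts) = qs" using c qs by auto
    moreover have "\<forall>z. z \<notin> Y \<longrightarrow> d z = a z" by (simp add: d_def b c)
    ultimately show ?case by blast
  qed
  then show ?case using qs by auto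
qed

text \<open>
  If two variables \<open>v\<^sub>1\<close>, \<open>v\<^sub>2\<close> of \<open>s\<close> shared \<open>y\<close> under \<open>\<mu>\<close>, rename \<open>y\<close> to a fresh variable in the
  value of \<open>v\<^sub>1\<close> only. Since the variables in \<open>Y\<close> occur just once, they can be adjusted to give a
  unifier again, and it does not factor through \<open>\<mu>\<close>.
\<close>

lemma mgu_linear_unique:
  fixes s :: "('f, 'v) trm"
  assumes inf: "infinite (UNIV :: 'v set)"
    and \<mu>: "app \<mu> s = app \<mu> (app \<sigma> t)"
      "\<And>\<tau>. app \<tau> s = app \<tau> (app \<sigma> t) \<Longrightarrow> absorbs \<tau> \<mu>"
    and Y: "Y \<subseteq> uvars t" "\<And>u. u \<in> Y \<Longrightarrow> \<sigma> u = Var u" "Y \<inter> vars s = {}"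
      "\<And>z. z \<in> vars t - Y \<Longrightarrow> Y \<inter> vars (\<sigma> z) = {}"
    and y: "\<And>z. z \<in> vars t - Y \<Longrightarrow> y \<notin> vars (app \<mu> (\<sigma> z))"
    and v: "v\<^sub>1 \<in> vars s" "y \<in> vars (\<mu> v\<^sub>1)" "v\<^sub>2 \<in> vars s" "y \<in> vars (\<mu> v\<^sub>2)"
  shows "v\<^sub>1 = v\<^sub>2"
proof (rule ccontr)
  assume neq: "v\<^sub>1 \<noteq> v\<^sub>2"
  have "finite (insert y (\<Union>v\<in>vars s. vars (\<mu> v)))" by (simp add: finite_vars)
  then obtain y' where y': "y' \<notin> insert y (\<Union>v\<in>vars s. vars (\<mu> v))"
    using inf ex_new_if_finite by blast
  define \<nu> where "\<nu> = \<mu>(v\<^sub>1 := app (Var(y := Var y')) (\<mu> v\<^sub>1))"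
  \<comment> \<open>Since \<open>y'\<close> is fresh, merging it back into \<open>y\<close> undoes
    the renaming made by \<open>\<nu>\<close>.\<close>
  have "app (Var(y' := Var y)) (\<nu> v) = \<mu> v" if "v \<in> vars s" for v
    using that y' by (auto simp: \<nu>_def app_app intro!: app_ident)
  then have "app (Var(y' := Var y)) (app \<nu> s) = app \<mu> s"
    by (auto simp: app_app intro: app_cong)
  then have "app (Var(y' := Var y)) (app \<nu> s) = app (\<lambda>z. app \<mu> (\<sigma> z)) t"
    by (simp add: \<mu>(1) app_app)
  then have "\<exists>b. app b t = app \<nu> s \<and> (\<forall>z. z \<notin> Y \<longrightarrow> b z = app \<mu> (\<sigma> z))"
    by (rule match_linear[OF refl]) (use Y(1) y in \<open>auto simp: uvars_def\<close>)
  then obtain b where b: "app b t = app \<nu> s" "\<And>z. z \<notin> Y \<Longrightarrow> b z = app \<mu> (\<sigma> z)"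
    by blast
  \<comment> \<open>\<open>Y\<close> avoids \<open>vars s\<close> and the values of the other
    variables of \<open>t\<close>, so the matched values on \<open>Y\<close> do not interfere with
    \<open>\<nu>\<close> elsewhere.\<close>
  define \<tau> where "\<tau> z = (if z \<in> Y then b z else \<nu> z)" for z
  have s: "app \<tau> s = app \<nu> s"
    using Y(3) by (intro app_cong) (auto simp: \<tau>_def)
  have "app \<tau> (\<sigma> z) = b z" if z: "z \<in> vars t" for z
  proof (cases "z \<in> Y")
    case True
    then show ?thesis by (simp add: Y(2) \<tau>_def)
  next
    case False
    \<comment> \<open>\<open>\<nu>\<close> differs from \<open>\<mu>\<close> only at
      \<open>v\<^sub>1\<close>, which cannot occur in this value: \<open>y\<close> occurs in its
      image under \<open>\<mu>\<close>.\<close>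
    have "app \<tau> (\<sigma> z) = app \<mu> (\<sigma> z)"
    proof (rule app_cong)
      fix w assume w: "w \<in> vars (\<sigma> z)"
      then have "w \<notin> Y" using Y(4) False z by auto
      moreover have "w \<noteq> v\<^sub>1" using y[of z] z False w v(2) by (auto simp: vars_app)
      ultimately show "\<tau> w = \<mu> w" by (simp add: \<tau>_def \<nu>_def)
    qed
    then show ?thesis using b(2) False by simp
  qed
  then have "app \<tau> (app \<sigma> t) = app b t" by (simp add: app_app app_eq_iff)
  then have abs: "absorbs \<tau> \<mu>" using \<mu>(2) s b(1) by simp
  have "v\<^sub>1 \<notin> Y" "v\<^sub>2 \<notin> Y" using Y(3) v by auto
  \<comment> \<open>Factoring through \<open>\<mu>\<close>, the occurrence of \<open>y\<close> in
    the value of \<open>v\<^sub>1\<close> forces the image \<open>y'\<close>, the one for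
    \<open>v\<^sub>2\<close> the image \<open>y\<close>.\<close>
  then have "app \<tau> (\<mu> v\<^sub>1) = app (Var(y := Var y')) (\<mu> v\<^sub>1)" "app \<tau> (\<mu> v\<^sub>2) = app Var (\<mu> v\<^sub>2)"
    using abs neq by (simp_all add: absorbs_def \<tau>_def \<nu>_def)
  then have "\<tau> y = Var y'" "\<tau> y = Var y"
    unfolding app_eq_iff using v by auto
  then show False using y' by simp
qed

subsection \<open>Sharing groups\<close>

lemma empty_sharing_group:
  assumes "infinite (UNIV :: 'v set)" "finite W"
  shows "{} \<in> sharing_groups (\<sigma> :: ('f, 'v) subst) W"
proof -
  have "finite (\<Union>u\<in>W. vars (\<sigma> u))"
    using assms(2) by (simp add: finite_vars)
  then obtain y where "y \<notin> (\<Union>u\<in>W. vars (\<sigma> u))"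
    using assms(1) ex_new_if_finite by blast
  then have "occ \<sigma> y \<inter> W = {}" by (auto simp: occ_def)
  then show ?thesis unfolding sharing_groups_def by blast
qed

text \<open>Being instances of each other on \<open>W\<close> stands in for a renaming:
  \<open>b\<close> inverts \<open>a\<close> on the variables in the values of
  \<open>\<sigma>\<close>, so \<open>a\<close> sends these injectively to variables. A group of
  \<open>\<tau>\<close> is then the group of the unique preimage, or empty.\<close>

lemma sharing_groups_instance:
  fixes \<sigma> \<tau> :: "('f, 'v) subst"
  assumes inf: "infinite (UNIV :: 'v set)" "finite W"
    and a: "\<And>w. w \<in> W \<Longrightarrow> \<tau> w = app a (\<sigma> w)"
    and b: "\<And>w. w \<in> W \<Longrightarrow> \<sigma> w = app b (\<tau> w)"
  shows "sharing_groups \<tau> W \<subseteq> sharing_groups \<sigma> W"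
proof
  fix G assume "G \<in> sharing_groups \<tau> W"
  then obtain y where G: "G = occ \<tau> y \<inter> W" by (auto simp: sharing_groups_def)
  define X where "X = (\<Union>w\<in>W. vars (\<sigma> w))"
  have ba: "app b (a v) = Var v" if v: "v \<in> X" for v
  proof -
    obtain w where w: "w \<in> W" "v \<in> vars (\<sigma> w)" using v by (auto simp: X_def)
    have "app b (app a (\<sigma> w)) = \<sigma> w" using a[OF w(1)] b[OF w(1)] by metis
    then have "app (\<lambda>z. app b (a z)) (\<sigma> w) = app Var (\<sigma> w)" by (simp add: app_app)
    then show ?thesis using w(2) unfolding app_eq_iff by blast
  qed
  have aV: "\<exists>w. a v = Var w \<and> b w = Var v" if "v \<in> X" for v
    using ba[OF that] by (cases "a v") auto
  show "G \<in> sharing_groups \<sigma> W"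
  proof (cases "\<exists>v\<in>X. a v = Var y")
    case True
    then obtain v where v: "v \<in> X" "a v = Var y" by blast
    have "y \<in> vars (a z) \<longleftrightarrow> z = v" if "z \<in> X" for z
      using aV[OF that] aV[OF v(1)] v(2) by auto
    then have "y \<in> vars (\<tau> w) \<longleftrightarrow> v \<in> vars (\<sigma> w)" if "w \<in> W" for w
      using that unfolding a[OF that] vars_app X_def by blast
    then have "G = occ \<sigma> v \<inter> W"
      unfolding G occ_def by auto
    then show ?thesis by (auto simp: sharing_groups_def)
  next
    case False
    then have "y \<notin> vars (a z)" if "z \<in> X" for z using aV[OF that] that by auto
    then have "y \<notin> vars (\<tau> w)" if "w \<in> W" for w
      using that unfolding a[OF that] vars_app X_def by blast
    then have "G = {}" unfolding G occ_def by auto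
    then show ?thesis using empty_sharing_group inf by blast
  qed
qed

section \<open>Effect of one binding on the sharing groups\<close>

text \<open>Here \<open>x\<close> occurs in no value but its own. Its group is \<open>{x}\<close>,
  and binding it only adds \<open>x\<close> to the groups of the variables of
  \<open>app \<sigma> t\<close>.\<close>

lemma sharing_groups_bind:
  fixes \<sigma> :: "('f, 'v) subst"
  assumes inf: "infinite (UNIV :: 'v set)" "finite W"
    and S: "sharing_groups \<sigma> W \<subseteq> S"
    and x: "x \<in> W" "\<sigma> x = Var x" "occ \<sigma> x = {x}" "x \<notin> vars t" and t: "vars t \<subseteq> W"
  shows "sharing_groups (\<sigma>(x := app \<sigma> t)) W \<subseteq>
    (S - (rel S (vars t) \<union> rel S {x})) \<union> bin (rel S {x}) (rel S (vars t))"
proof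
  fix G assume "G \<in> sharing_groups (\<sigma>(x := app \<sigma> t)) W"
  then obtain y where G: "G = occ (\<sigma>(x := app \<sigma> t)) y \<inter> W" by (auto simp: sharing_groups_def)
  have inS: "occ \<sigma> v \<inter> W \<in> S" for v using S by (auto simp: sharing_groups_def)
  have xt: "x \<notin> vars (app \<sigma> t)" using x(3,4) by (auto simp: vars_app occ_def)
  show "G \<in> (S - (rel S (vars t) \<union> rel S {x})) \<union> bin (rel S {x}) (rel S (vars t))"
  proof (cases "y = x")
    case True
    then have "G = {}" using x(3) xt G by (auto simp: occ_def)
    then show ?thesis using empty_sharing_group[OF inf] S by (auto simp: rel_def)
  next
    case False
    show ?thesis
    proof (cases "y \<in> vars (app \<sigma> t)")
      case True
      then obtain z where z: "z \<in> vars t" "z \<in> occ \<sigma> y" by (auto simp: vars_app occ_def)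
      have "G = {x} \<union> (occ \<sigma> y \<inter> W)" using True x(1,2) False G by (auto simp: occ_def)
      moreover have "{x} \<in> rel S {x}" using inS[of x] x by (auto simp: rel_def)
      moreover have "occ \<sigma> y \<inter> W \<in> rel S (vars t)" using inS z t by (auto simp: rel_def)
      ultimately show ?thesis unfolding bin_def by blast
    next
      case notin: False
      then have "G = occ \<sigma> y \<inter> W" using x(2) False G by (auto simp: occ_def)
      moreover have "x \<notin> occ \<sigma> y" using x(2) False by (auto simp: occ_def)
      moreover have "occ \<sigma> y \<inter> vars t = {}" using notin by (auto simp: vars_app occ_def)
      ultimately show ?thesis using inS[of y] by (auto simp: rel_def)
    qed
  qed
qed

lemma Union_in_star:
  assumes "finite B" "B \<noteq> {}" "\<And>v. v \<in> B \<Longrightarrow> g v \<in> A"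
  shows "(\<Union>v\<in>B. g v) \<in> star A"
  unfolding star_def using assms by (intro CollectI exI[of _ "g ` B"]) auto

lemma binI: "P \<in> A \<Longrightarrow> Q \<in> B \<Longrightarrow> P \<union> Q \<in> bin A B"
  by (auto simp: bin_def)

text \<open>If \<open>y\<close> is absent from the common value of \<open>x\<close> and
  \<open>t\<close>, its group is empty or an old group avoiding \<open>x\<close> and
  \<open>vars t\<close>. Otherwise the variables \<open>B\<close> whose value under
  \<open>\<mu>\<close> contains \<open>y\<close> come from \<open>\<sigma> x\<close>, from
  \<open>Z\<close> or from \<open>Y\<close>, and their old groups yield the factors of the abstract
  formula.\<close>

lemma sharing_groups_mgu:
  fixes \<sigma> :: "('f, 'v) subst"
  assumes inf: "infinite (UNIV :: 'v set)" "finite W"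
    and S: "sharing_groups \<sigma> W \<subseteq> S"
    and W: "x \<in> W" "vars t \<subseteq> W"
    and \<mu>: "app \<mu> (\<sigma> x) = app \<mu> (app \<sigma> t)" "svars \<mu> \<subseteq> vars (\<sigma> x) \<union> vars (app \<sigma> t)"
      "\<And>\<tau>. app \<tau> (\<sigma> x) = app \<tau> (app \<sigma> t) \<Longrightarrow> absorbs \<tau> \<mu>"
    and Y: "Y \<subseteq> uvars t" "\<And>u. u \<in> Y \<Longrightarrow> \<sigma> u = Var u" "Y \<inter> vars (\<sigma> x) = {}"
      "\<And>z. z \<in> vars t - Y \<Longrightarrow> Y \<inter> vars (\<sigma> z) = {}"
    and Z: "Z = vars t - Y"
  shows "sharing_groups (\<lambda>z. app \<mu> (\<sigma> z)) W \<subseteq>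
    (S - (rel S (vars t) \<union> rel S {x}))
     \<union> bin (rel S {x}) (star (rel S Y))
     \<union> bin (star (rel S {x})) (star (rel S Z))
     \<union> bin (bin (star (rel S {x})) (star (rel S Z))) (star (rel S Y))"
proof
  fix G assume "G \<in> sharing_groups (\<lambda>z. app \<mu> (\<sigma> z)) W"
  then obtain y where G: "G = occ (\<lambda>z. app \<mu> (\<sigma> z)) y \<inter> W" by (auto simp: sharing_groups_def)
  define g where "g v = occ \<sigma> v \<inter> W" for v
  define B where "B = {v. y \<in> vars (\<mu> v)}"
  have gS: "g v \<in> S" for v using S by (auto simp: sharing_groups_def g_def)
  have GB: "G = (\<Union>v\<in>B. g v)"
    unfolding G B_def g_def by (auto simp: occ_def vars_app)
  have Yt: "Y \<subseteq> vars t"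
  proof
    fix u assume "u \<in> Y"
    then have "occurrences u t \<noteq> 0" using Y(1) by (auto simp: uvars_def)
    then show "u \<in> vars t" by (simp add: occurrences_eq_0_iff)
  qed
  have vt: "vars (app \<sigma> t) = Y \<union> (\<Union>z\<in>Z. vars (\<sigma> z))"
    using Y(2) Yt unfolding Z vars_app by fastforce
  let ?R = "(S - (rel S (vars t) \<union> rel S {x}))
     \<union> bin (rel S {x}) (star (rel S Y))
     \<union> bin (star (rel S {x})) (star (rel S Z))
     \<union> bin (bin (star (rel S {x})) (star (rel S Z))) (star (rel S Y))"
  show "G \<in> ?R"
  proof (cases "y \<in> vars (app \<mu> (\<sigma> x))")
    case False
    then have y: "y \<notin> vars (app \<mu> (app \<sigma> t))" using \<mu>(1) by simp
    have B: "v = y \<and> y \<notin> vars (\<sigma> x) \<union> vars (app \<sigma> t)" if "v \<in> B" for v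
    proof -
      have "v \<notin> vars (\<sigma> x) \<union> vars (app \<sigma> t)"
        using that False y by (auto simp: B_def vars_app)
      moreover from this have "\<mu> v = Var v" using \<mu>(2) by (intro notin_svars) auto
      ultimately show ?thesis using that by (auto simp: B_def)
    qed
    show ?thesis
    proof (cases "B = {}")
      case True
      then show ?thesis using GB empty_sharing_group[OF inf] S by (auto simp: rel_def)
    next
      case False
      then have "G = g y" "y \<notin> vars (\<sigma> x) \<union> vars (app \<sigma> t)" using B GB by auto
      moreover from this have "g y \<inter> vars t = {}" "x \<notin> g y"
        by (auto simp: g_def occ_def vars_app)
      ultimately show ?thesis using gS[of y] by (auto simp: rel_def)
    qed
  next
    case True
    then have yt: "y \<in> vars (app \<mu> (app \<sigma> t))" using \<mu>(1) by simp
    \<comment> \<open>A variable foreign to the equation is fixed by \<open>\<mu>\<close>, so it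
      could only be \<open>y\<close>; but \<open>\<mu>\<close> yields \<open>y\<close> from some
      variable of \<open>\<sigma> x\<close>, which must then be \<open>y\<close> itself.\<close>
    have B: "B \<subseteq> vars (\<sigma> x) \<union> vars (app \<sigma> t)"
    proof
      fix v assume v: "v \<in> B"
      show "v \<in> vars (\<sigma> x) \<union> vars (app \<sigma> t)"
      proof (rule ccontr)
        assume v': "v \<notin> vars (\<sigma> x) \<union> vars (app \<sigma> t)"
        then have "\<mu> v = Var v" using \<mu>(2) by (intro notin_svars) auto
        then have "y = v" using v by (simp add: B_def)
        then have "y \<notin> svars \<mu>" using v' \<mu>(2) by auto
        moreover obtain w where "w \<in> vars (\<sigma> x)" "y \<in> vars (\<mu> w)"
          using True by (auto simp: vars_app)
        ultimately show False using notin_svars_range v' \<open>y = v\<close> by fastforce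
      qed
    qed
    define Bx where "Bx = B \<inter> vars (\<sigma> x)"
    define By where "By = B \<inter> Y"
    define Bz where "Bz = B \<inter> (\<Union>z\<in>Z. vars (\<sigma> z))"
    have fin: "finite Bx" "finite By" "finite Bz"
      using finite_subset[OF Yt finite_vars] by (auto simp: Bx_def By_def Bz_def Z finite_vars)
    have GBs: "G = (\<Union>v\<in>Bx. g v) \<union> (\<Union>v\<in>Bz. g v) \<union> (\<Union>v\<in>By. g v)"
    proof -
      have "B = Bx \<union> Bz \<union> By"
        using B unfolding Bx_def By_def Bz_def vt by blast
      then show ?thesis unfolding GB by (simp add: UN_Un)
    qed
    have gx: "g v \<in> rel S {x}" if "v \<in> Bx" for v
      using that gS W by (auto simp: Bx_def rel_def g_def occ_def)
    have gy: "g u \<in> rel S Y" if "u \<in> By" for u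
    proof -
      have "u \<in> Y" "u \<in> g u" using that W(2) Yt Y(2)[of u] by (auto simp: By_def g_def occ_def)
      then show ?thesis using gS[of u] by (auto simp: rel_def)
    qed
    have gz: "g v \<in> rel S Z" if v: "v \<in> Bz" for v
    proof -
      obtain z where "z \<in> Z" "v \<in> vars (\<sigma> z)" using v by (auto simp: Bz_def)
      then have "z \<in> Z \<inter> g v" using W(2) Z by (auto simp: g_def occ_def)
      then show ?thesis using gS[of v] by (auto simp: rel_def)
    qed
    have "Bx \<noteq> {}" using True by (auto simp: Bx_def B_def vars_app)
    then have star_x: "(\<Union>v\<in>Bx. g v) \<in> star (rel S {x})"
      using fin gx by (intro Union_in_star)
    have yz: "By \<noteq> {} \<or> Bz \<noteq> {}"
    proof -
      obtain v where "v \<in> vars (app \<sigma> t)" "v \<in> B"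
        using yt by (subst (asm) vars_app) (auto simp: B_def)
      then show ?thesis by (auto simp: vt By_def Bz_def)
    qed
    show ?thesis
    proof (cases "Bz = {}")
      case True
      then have "By \<noteq> {}" using yz by simp
      then have star_y: "(\<Union>v\<in>By. g v) \<in> star (rel S Y)" using fin gy by (intro Union_in_star)
      \<comment> \<open>With \<open>Bz\<close> empty, \<open>y\<close> reaches \<open>t\<close>
        through \<open>Y\<close> only. This is the linear situation, in which a single group of
        \<open>x\<close> is involved.\<close>
      have "y \<notin> vars (app \<mu> (\<sigma> z))" if "z \<in> vars t - Y" for z
        using True that by (auto simp: Bz_def B_def Z vars_app)
      note uniq = mgu_linear_unique[OF inf(1) \<mu>(1,3) Y this]
      obtain v where "v \<in> Bx" using \<open>Bx \<noteq> {}\<close> by blast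
      then have "Bx = {v}" using uniq by (auto simp: Bx_def B_def)
      then have "(\<Union>v\<in>Bx. g v) \<in> rel S {x}" using gx by simp
      then have "G \<in> bin (rel S {x}) (star (rel S Y))"
        using star_y True unfolding GBs by (auto intro: binI)
      then show ?thesis by blast
    next
      case False
      then have "(\<Union>v\<in>Bz. g v) \<in> star (rel S Z)" using fin gz by (intro Union_in_star)
      then have xz: "(\<Union>v\<in>Bx. g v) \<union> (\<Union>v\<in>Bz. g v) \<in> bin (star (rel S {x})) (star (rel S Z))"
        using star_x by (rule binI[rotated])
      show ?thesis
      proof (cases "By = {}")
        case True
        then show ?thesis using xz GBs by simp
      next
        case False
        then have "(\<Union>v\<in>By. g v) \<in> star (rel S Y)" using fin gy by (intro Union_in_star)
        then show ?thesis using binI[OF xz] GBs by blast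
      qed
    qed
  qed
qed

subsection \<open>Correctness of the abstract operator\<close>

text \<open>
  Variables in \<open>U\<close> are still unbound, and the variables they may have been put into are bound by
  bindings that were processed earlier.
\<close>

definition free_in :: "('f, 'v) subst \<Rightarrow> 'v set \<Rightarrow> ('v \<times> ('f, 'v) trm) list \<Rightarrow> bool" where
  "free_in \<sigma> U bs \<longleftrightarrow> (\<forall>u\<in>U. \<sigma> u = Var u \<and> (\<forall>z\<in>occ \<sigma> u. z = u \<or>
     (\<forall>(x, t)\<in>set bs. u \<noteq> x \<and> z \<noteq> x \<and> z \<notin> vars t)))"

text \<open>Induction on the bindings. \<open>\<sigma>'\<close> is a most general refinement of
  \<open>\<sigma>\<close> that solves them; the fixed \<open>\<tau>\<close> guarantees that every
  step is solvable. \<open>S\<close> may be any superset of the groups, since the intermediate sets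
  of the recursion are only upper bounds.\<close>

lemma u_Sh_correct:
  fixes \<sigma> :: "('f, 'v) subst"
  assumes inf: "infinite (UNIV :: 'v set)" "finite W"
    and "\<sigma> \<in> Subst ar" "\<forall>(x, t)\<in>set bs. wf_trm ar t \<and> x \<in> W \<and> vars t \<subseteq> W"
    and "distinct (map fst bs)" "\<forall>(x, t)\<in>set bs. \<forall>(y, r)\<in>set bs. x \<notin> vars r"
    and "absorbs \<tau> \<sigma>" "\<forall>(x, t)\<in>set bs. \<tau> x = app \<tau> t"
    and "free_in \<sigma> U bs" "sharing_groups \<sigma> W \<subseteq> S"
  shows "\<exists>\<sigma>'\<in>Subst ar. (\<exists>\<eta>. \<forall>z. \<sigma>' z = app \<eta> (\<sigma> z)) \<and>
    (\<forall>(x, t)\<in>set bs. \<sigma>' x = app \<sigma>' t) \<and>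
    (\<forall>\<tau>. absorbs \<tau> \<sigma> \<longrightarrow> (\<forall>(x, t)\<in>set bs. \<tau> x = app \<tau> t) \<longrightarrow> absorbs \<tau> \<sigma>') \<and>
    sharing_groups \<sigma>' W \<subseteq> u_Sh S U bs"
  using assms(3-)
proof (induction bs arbitrary: \<sigma> U S)
  case Nil
  then show ?case
    by (intro bexI[of _ \<sigma>]) (auto intro: exI[of _ Var])
next
  case (Cons b bs)
  obtain x t where b: "b = (x, t)" by force
  have xt: "wf_trm ar t" "x \<in> W" "vars t \<subseteq> W" "x \<notin> vars t" "\<tau> x = app \<tau> t"
    using Cons.prems(2,4,6) b by auto
  have x_new: "x \<noteq> y \<and> x \<notin> vars r \<and> y \<notin> vars t" if "(y, r) \<in> set bs" for y r
    using Cons.prems(3,4) b that by force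
  have free: "\<sigma> u = Var u" "\<And>z. z \<in> occ \<sigma> u \<Longrightarrow> z = u \<or>
     u \<noteq> x \<and> z \<noteq> x \<and> z \<notin> vars t \<and> (\<forall>(x, t)\<in>set bs. u \<noteq> x \<and> z \<noteq> x \<and> z \<notin> vars t)"
    if "u \<in> U" for u
    using Cons.prems(7) that unfolding free_in_def b by auto
  have wf: "wf_trm ar (\<sigma> x)" "wf_trm ar (app \<sigma> t)"
    using Cons.prems(1) xt(1) by (auto simp: Subst_def intro: wf_app)
  \<comment> \<open>Both recursive clauses are brought to one interface: an mgu, a set covering the
    new groups, and the variables that are still free.\<close>
  obtain \<mu> S' U' where \<mu>: "\<mu> \<in> Subst ar" "app \<mu> (\<sigma> x) = app \<mu> (app \<sigma> t)"
      "\<And>\<tau>. app \<tau> (\<sigma> x) = app \<tau> (app \<sigma> t) \<Longrightarrow> absorbs \<tau> \<mu>"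
    and S': "sharing_groups (\<lambda>z. app \<mu> (\<sigma> z)) W \<subseteq> S'" and U': "free_in (\<lambda>z. app \<mu> (\<sigma> z)) U' bs"
    and u_Sh: "u_Sh S U (b # bs) = u_Sh S' U' bs"
  proof (cases "x \<in> U")
    case True
    \<comment> \<open>As \<open>x\<close> is unbound and occurs in no other value, this single
      binding is already the mgu, and composing with it is a point update.\<close>
    define \<mu> where "\<mu> = Var(x := app \<sigma> t)"
    have x: "\<sigma> x = Var x" "occ \<sigma> x = {x}"
      using free[OF True] by (auto simp: occ_def)
    then have xt': "x \<notin> vars (app \<sigma> t)" using xt(4) by (auto simp: vars_app occ_def)
    have "app \<mu> (\<sigma> z) = \<sigma> z" if "z \<noteq> x" for z
    proof -
      have "x \<notin> vars (\<sigma> z)" using x(2) that unfolding occ_def by blast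
      then show ?thesis unfolding \<mu>_def by (intro app_ident) auto
    qed
    then have \<sigma>': "(\<lambda>z. app \<mu> (\<sigma> z)) = \<sigma>(x := app \<sigma> t)"
      using x(1) by (intro ext) (simp add: \<mu>_def)
    show ?thesis
    proof (rule that)
      show "\<mu> \<in> Subst ar" unfolding \<mu>_def by (intro Subst_upd Var_in_Subst wf)
      show "app \<mu> (\<sigma> x) = app \<mu> (app \<sigma> t)"
        using x(1) xt' by (auto simp: \<mu>_def intro!: app_ident[symmetric])
      show "absorbs \<upsilon> \<mu>" if "app \<upsilon> (\<sigma> x) = app \<upsilon> (app \<sigma> t)" for \<upsilon>
        using that x(1) by (simp add: \<mu>_def absorbs_upd)
      show "sharing_groups (\<lambda>z. app \<mu> (\<sigma> z)) W \<subseteq>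
          (S - (rel S (vars t) \<union> rel S {x})) \<union> bin (rel S {x}) (rel S (vars t))"
        unfolding \<sigma>' by (intro sharing_groups_bind inf Cons.prems(8) xt x)
      show "u_Sh S U (b # bs) = u_Sh ((S - (rel S (vars t) \<union> rel S {x})) \<union>
          bin (rel S {x}) (rel S (vars t))) (U - {x}) bs"
        using True b by simp
      show "free_in (\<lambda>z. app \<mu> (\<sigma> z)) (U - {x}) bs"
        unfolding free_in_def \<sigma>'
      proof (intro ballI conjI)
        fix u assume u: "u \<in> U - {x}"
        then show "(\<sigma>(x := app \<sigma> t)) u = Var u" using free by simp
        fix z assume z: "z \<in> occ (\<sigma>(x := app \<sigma> t)) u"
        show "z = u \<or> (\<forall>(x, t)\<in>set bs. u \<noteq> x \<and> z \<noteq> x \<and> z \<notin> vars t)"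
        proof (cases "z = x")
          case True
          \<comment> \<open>A new occurrence of \<open>u\<close> enters through \<open>x\<close>,
            hence from a variable of \<open>t\<close>, which by freeness is \<open>u\<close> itself.
            Later bindings neither bind a variable of \<open>t\<close> nor mention
            \<open>x\<close>.\<close>
          then obtain w where w: "w \<in> vars t" "w \<in> occ \<sigma> u"
            using z by (auto simp: occ_def vars_app)
          then have "u \<in> vars t" using free(2)[of u w] u by auto
          then show ?thesis using x_new True by blast
        next
          case False
          then have "z \<in> occ \<sigma> u" using z by (simp add: occ_def)
          then show ?thesis using free(2)[of u z] u by auto
        qed
      qed
    qed
  next
    case False
    define Y where "Y = uvars t \<inter> U"
    have "\<forall>(s, r)\<in>set [(\<sigma> x, app \<sigma> t)]. app \<tau> s = app \<tau> r"
      using Cons.prems(5) xt(5) by (simp add: absorbs_app) (simp add: absorbs_def)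
    from mgu_exists[OF this, of ar] wf obtain \<mu> where \<mu>: "\<mu> \<in> Subst ar"
      "svars \<mu> \<subseteq> vars (\<sigma> x) \<union> vars (app \<sigma> t)" "app \<mu> (\<sigma> x) = app \<mu> (app \<sigma> t)"
      "\<And>\<tau>. app \<tau> (\<sigma> x) = app \<tau> (app \<sigma> t) \<Longrightarrow> absorbs \<tau> \<mu>"
      by auto
    have "z = u" if "u \<in> U" "u \<in> vars (\<sigma> z)" "z = x \<or> z \<in> vars t" for u z
      using free(2)[OF that(1), of z] that by (auto simp: occ_def)
    note U = this
    show ?thesis
    proof (rule that)
      show "\<mu> \<in> Subst ar" "app \<mu> (\<sigma> x) = app \<mu> (app \<sigma> t)" by fact+
      show "absorbs \<upsilon> \<mu>" if "app \<upsilon> (\<sigma> x) = app \<upsilon> (app \<sigma> t)" for \<upsilon>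
        using that by (rule \<mu>(4))
      show "sharing_groups (\<lambda>z. app \<mu> (\<sigma> z)) W \<subseteq>
          (S - (rel S (vars t) \<union> rel S {x}))
           \<union> bin (rel S {x}) (star (rel S Y))
           \<union> bin (star (rel S {x})) (star (rel S (vars t - Y)))
           \<union> bin (bin (star (rel S {x})) (star (rel S (vars t - Y)))) (star (rel S Y))"
      proof (rule sharing_groups_mgu[OF inf Cons.prems(8) xt(2,3) \<mu>(3,2,4) _ _ _ _ refl])
        show "Y \<inter> vars (\<sigma> x) = {}" using U[of _ x] False by (auto simp: Y_def)
        show "Y \<inter> vars (\<sigma> z) = {}" if "z \<in> vars t - Y" for z
          using U[of _ z] that by (auto simp: Y_def)
      qed (auto simp: Y_def free)
      show "u_Sh S U (b # bs) = u_Sh ((S - (rel S (vars t) \<union> rel S {x}))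
           \<union> bin (rel S {x}) (star (rel S Y))
           \<union> bin (star (rel S {x})) (star (rel S (vars t - Y)))
           \<union> bin (bin (star (rel S {x})) (star (rel S (vars t - Y)))) (star (rel S Y)))
          (U - ({x} \<union> vars t)) bs"
        using False b by (simp add: Y_def Let_def)
      show "free_in (\<lambda>z. app \<mu> (\<sigma> z)) (U - ({x} \<union> vars t)) bs"
        unfolding free_in_def
      proof (intro ballI conjI)
        fix u assume u: "u \<in> U - ({x} \<union> vars t)"
        \<comment> \<open>\<open>\<mu>\<close> only involves variables of the equation, which
          \<open>u\<close> avoids, so it neither binds \<open>u\<close> nor introduces new
          occurrences of it.\<close>
        then have "u \<notin> vars (\<sigma> x) \<union> vars (app \<sigma> t)" using U[of u] by (auto simp: vars_app)
        then have u': "u \<notin> svars \<mu>" using \<mu>(2) by blast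
        then show "app \<mu> (\<sigma> u) = Var u" using free(1)[of u] u by (simp add: notin_svars)
        fix z assume "z \<in> occ (\<lambda>z. app \<mu> (\<sigma> z)) u"
        then obtain w where "w \<in> vars (\<sigma> z)" "u \<in> vars (\<mu> w)" by (auto simp: occ_def vars_app)
        then have "z \<in> occ \<sigma> u" using notin_svars_range[OF u'] by (auto simp: occ_def)
        then show "z = u \<or> (\<forall>(x, t)\<in>set bs. u \<noteq> x \<and> z \<noteq> x \<and> z \<notin> vars t)"
          using free(2)[of u z] u by auto
      qed
    qed
  qed
  let ?\<sigma> = "\<lambda>z. app \<mu> (\<sigma> z)"
  have abs: "absorbs \<upsilon> ?\<sigma>" if "absorbs \<upsilon> \<sigma>" "\<upsilon> x = app \<upsilon> t" for \<upsilon>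
  proof (rule absorbs_comp)
    have "app \<upsilon> (\<sigma> x) = app \<upsilon> (app \<sigma> t)"
      using that by (simp add: absorbs_app) (simp add: absorbs_def)
    then show "absorbs \<upsilon> \<mu>" by (rule \<mu>(3))
  qed fact
  have "\<exists>\<sigma>'\<in>Subst ar. (\<exists>\<eta>. \<forall>z. \<sigma>' z = app \<eta> (?\<sigma> z)) \<and>
    (\<forall>(x, t)\<in>set bs. \<sigma>' x = app \<sigma>' t) \<and>
    (\<forall>\<tau>. absorbs \<tau> ?\<sigma> \<longrightarrow> (\<forall>(x, t)\<in>set bs. \<tau> x = app \<tau> t) \<longrightarrow> absorbs \<tau> \<sigma>') \<and>
    sharing_groups \<sigma>' W \<subseteq> u_Sh S' U' bs"
  proof (rule Cons.IH)
    show "?\<sigma> \<in> Subst ar" using \<mu>(1) Cons.prems(1) by (rule Subst_comp)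
    show "absorbs \<tau> ?\<sigma>" using Cons.prems(5) xt(5) by (rule abs)
  qed (use Cons.prems S' U' in auto)
  then obtain \<sigma>' \<eta> where \<sigma>': "\<sigma>' \<in> Subst ar" "\<And>z. \<sigma>' z = app \<eta> (?\<sigma> z)"
    "\<forall>(x, t)\<in>set bs. \<sigma>' x = app \<sigma>' t"
    "\<And>\<tau>. absorbs \<tau> ?\<sigma> \<Longrightarrow> \<forall>(x, t)\<in>set bs. \<tau> x = app \<tau> t \<Longrightarrow> absorbs \<tau> \<sigma>'"
    "sharing_groups \<sigma>' W \<subseteq> u_Sh S' U' bs" by blast
  show ?case
  proof (intro bexI[OF _ \<sigma>'(1)] conjI)
    show "\<exists>\<eta>. \<forall>z. \<sigma>' z = app \<eta> (\<sigma> z)" using \<sigma>'(2) by (auto simp: app_app)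
    have "app \<sigma>' t = app \<eta> (app \<mu> (app \<sigma> t))"
      unfolding app_app by (rule app_cong) (simp add: \<sigma>'(2) app_app)
    then have "\<sigma>' x = app \<sigma>' t" using \<sigma>'(2) \<mu>(2) by simp
    then show "\<forall>(x, t)\<in>set (b # bs). \<sigma>' x = app \<sigma>' t" using \<sigma>'(3) b by simp
    show "\<forall>\<tau>. absorbs \<tau> \<sigma> \<longrightarrow> (\<forall>(x, t)\<in>set (b # bs). \<tau> x = app \<tau> t) \<longrightarrow> absorbs \<tau> \<sigma>'"
      using \<sigma>'(4) abs b by simp
    show "sharing_groups \<sigma>' W \<subseteq> u_Sh S U (b # bs)" using \<sigma>'(5) u_Sh by simp
  qed
qed

section \<open>Existential substitutions and their representatives\<close>

lemma Renaming_inverse: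
  assumes "\<rho> \<in> Renaming ar"
  shows "\<exists>\<rho>'\<in>Renaming ar. \<forall>t. app \<rho>' (app \<rho> t) = t"
proof -
  obtain \<pi> where \<pi>: "bij \<pi>" "\<rho> = Var \<circ> \<pi>" using assms by (auto simp: Renaming_def)
  have "inv \<pi> z = z \<longleftrightarrow> \<pi> z = z" for z
    using \<pi>(1) by (metis bij_inv_eq_iff)
  then have "sdom (Var \<circ> inv \<pi> :: ('b, 'a) subst) = sdom \<rho>" by (simp add: sdom_def \<pi>)
  then have "(Var \<circ> inv \<pi>) \<in> Renaming ar"
    using assms bij_imp_bij_inv[OF \<pi>(1)] unfolding Renaming_def Subst_def by auto
  moreover have "app (Var \<circ> inv \<pi>) (app \<rho> t) = t" for t
    using \<pi> by (simp add: app_app bij_is_inj)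
  ultimately show ?thesis by blast
qed

lemma esim_sym:
  assumes "(\<theta>\<^sub>1, \<theta>\<^sub>2) \<in> esim ar U"
  shows "(\<theta>\<^sub>2, \<theta>\<^sub>1) \<in> esim ar U"
proof -
  obtain \<rho> where \<rho>: "\<rho> \<in> Renaming ar" "\<forall>u\<in>U. \<theta>\<^sub>1 u = app \<rho> (\<theta>\<^sub>2 u)"
    using assms unfolding esim_def by blast
  obtain \<rho>' where "\<rho>' \<in> Renaming ar" "\<forall>t. app \<rho>' (app \<rho> t) = t"
    using Renaming_inverse[OF \<rho>(1)] by blast
  then have "\<exists>\<rho>'\<in>Renaming ar. \<forall>u\<in>U. \<theta>\<^sub>2 u = app \<rho>' (\<theta>\<^sub>1 u)"
    using \<rho>(2) by (intro bexI[of _ \<rho>']) auto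
  then show ?thesis
    using assms unfolding esim_def by blast
qed

lemma equiv_esim: "equiv (ISubst ar) (esim ar U)"
proof (rule equivI)
  show "esim ar U \<subseteq> ISubst ar \<times> ISubst ar" by (auto simp: esim_def)
  have "Var \<in> Renaming ar" by (auto simp: Renaming_def Var_in_Subst intro!: exI[of _ id])
  then show "refl_on (ISubst ar) (esim ar U)"
    by (force simp: refl_on_def esim_def)
  show "sym (esim ar U)" by (auto intro: symI esim_sym)
  show "trans (esim ar U)"
  proof (rule transI)
    fix a b c assume "(a, b) \<in> esim ar U" "(b, c) \<in> esim ar U"
    then obtain \<rho> \<rho>' where *: "a \<in> ISubst ar" "c \<in> ISubst ar" "\<rho> \<in> Renaming ar" "\<rho>' \<in> Renaming ar"
      "\<forall>u\<in>U. a u = app \<rho> (app \<rho>' (c u))"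
      by (auto simp: esim_def)
    obtain \<pi> \<pi>' where "bij \<pi>" "\<rho> = Var \<circ> \<pi>" "bij \<pi>'" "\<rho>' = Var \<circ> \<pi>'"
      using *(3,4) by (auto simp: Renaming_def)
    then have "bij (\<pi> \<circ> \<pi>')" "(\<lambda>z. app \<rho> (\<rho>' z)) = Var \<circ> (\<pi> \<circ> \<pi>')"
      by (auto simp: bij_comp)
    then have "(\<lambda>z. app \<rho> (\<rho>' z)) \<in> Renaming ar"
      using *(3,4) Subst_comp[of \<rho> ar \<rho>'] unfolding Renaming_def by blast
    then show "(a, c) \<in> esim ar U" using * by (auto simp: esim_def app_app)
  qed
qed

text \<open>A renaming and its inverse make two representatives instances of each other; by symmetry
  the groups belong to the class.\<close>

lemma sharing_groups_esim:
  fixes \<sigma> \<tau> :: "('f, 'v) subst"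
  assumes "infinite (UNIV :: 'v set)" "finite W" "(\<sigma>, \<tau>) \<in> esim ar W"
  shows "sharing_groups \<sigma> W \<subseteq> sharing_groups \<tau> W"
proof -
  obtain \<rho> \<rho>' where "\<forall>w\<in>W. \<sigma> w = app \<rho> (\<tau> w)" "\<forall>w\<in>W. \<tau> w = app \<rho>' (\<sigma> w)"
    using assms(3) esim_sym[OF assms(3)] unfolding esim_def by blast
  then show ?thesis
    using assms(1,2) sharing_groups_instance[of W \<sigma> \<rho> \<tau> \<rho>'] by blast
qed

section \<open>Solving the original bindings instead of a renamed copy\<close>

text \<open>
  Instead of \<open>\<theta>\<^sub>2\<close>, a renamed copy of \<open>\<theta>\<close>, the bindings of \<open>\<theta>\<close> itself are solved on top of \<open>\<theta>\<^sub>1\<close>. The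
  resulting substitution \<open>m\<close> and \<open>\<mu>\<close> are instances of each other on the variables of interest.
\<close>

lemma sharing_groups_is_mgu:
  fixes \<theta> :: "('f, 'v) subst"
  assumes inf: "infinite (UNIV :: 'v set)" and U: "finite U"
    and \<theta>: "\<theta> \<in> ISubst ar" "\<theta>\<^sub>1 \<in> ISubst ar" "(\<theta>\<^sub>2, \<theta>) \<in> esim ar (svars \<theta>)"
    and disj: "(U \<union> svars \<theta>\<^sub>1) \<inter> (svars \<theta> \<union> svars \<theta>\<^sub>2) \<subseteq> U \<inter> svars \<theta>"
    and mgu: "is_mgu ar \<theta>\<^sub>1 \<theta>\<^sub>2 \<mu>"
    and bs: "bs \<in> binding_lists \<theta>"
    and S: "sharing_groups \<theta>\<^sub>1 U \<subseteq> S"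
  shows "sharing_groups \<mu> (U \<union> svars \<theta>) \<subseteq>
    u_Sh (S \<union> {{x} | x. x \<in> svars \<theta> - U}) (svars \<theta> - U) bs"
proof -
  define V where "V = svars \<theta>"
  define W where "W = U \<union> V"
  obtain \<pi> where \<pi>: "bij \<pi>" "\<And>v. v \<in> V \<Longrightarrow> \<theta>\<^sub>2 v = app (Var \<circ> \<pi>) (\<theta> v)" and \<theta>2: "\<theta>\<^sub>2 \<in> ISubst ar"
    using \<theta>(3) by (auto simp: esim_def Renaming_def V_def)
  have "finite V"
    using \<theta>(1) by (auto simp: V_def svars_def srng_def ISubst_def Subst_def finite_vars)
  then have W: "finite W" using U by (simp add: W_def)
  have Var_V: "\<theta>\<^sub>2 v = Var (\<pi> v)" if "v \<in> V - sdom \<theta>" for v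
    using \<pi>(2)[of v] that by (simp add: sdom_def)
  have vars_V: "vars (\<theta> x) \<subseteq> V - sdom \<theta>" if "x \<in> sdom \<theta>" for x
    using \<theta>(1) that by (auto simp: V_def ISubst_def svars_def srng_def)

  \<comment> \<open>Separation keeps these variables out of \<open>\<theta>\<^sub>1\<close>, so
    initially they are unbound and occur only in their own value.\<close>
  have U2: "u \<notin> svars \<theta>\<^sub>1" if "u \<in> V - U" for u
    using disj that by (auto simp: V_def)
  have set_bs: "set bs = {(x, \<theta> x) | x. x \<in> sdom \<theta>}" "distinct bs"
    using bs by (auto simp: binding_lists_def)
  have bs_iff: "(\<forall>(x, t)\<in>set bs. \<tau> x = app \<tau> t) \<longleftrightarrow> absorbs \<tau> \<theta>" for \<tau>
  proof -
    have "(\<forall>(x, t)\<in>set bs. \<tau> x = app \<tau> t) \<longleftrightarrow> (\<forall>x\<in>sdom \<theta>. \<tau> x = app \<tau> (\<theta> x))"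
      by (auto simp: set_bs)
    moreover have "app \<tau> (\<theta> x) = \<tau> x" if "x \<notin> sdom \<theta>" for x
      using that by (simp add: sdom_def)
    ultimately show ?thesis unfolding absorbs_def by metis
  qed

  have eqs: "(\<forall>(s, t)\<in>equations \<theta>\<^sub>1 \<union> equations \<theta>\<^sub>2. app \<tau> s = app \<tau> t) \<longleftrightarrow>
      absorbs \<tau> \<theta>\<^sub>1 \<and> absorbs \<tau> \<theta>\<^sub>2" for \<tau>
    by (simp add: ball_Un unifiers_equations)
  have \<mu>: "absorbs \<mu> \<theta>\<^sub>1" "absorbs \<mu> \<theta>\<^sub>2"
    using mgu eqs unfolding is_mgu_def Let_def unifiers_def by auto
  have gen: "\<exists>\<delta>. \<tau> = app \<delta> \<circ> \<mu>" if "\<tau> \<in> Subst ar" "absorbs \<tau> \<theta>\<^sub>1" "absorbs \<tau> \<theta>\<^sub>2" for \<tau>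
    using mgu eqs that unfolding is_mgu_def Let_def unifiers_def by blast
  \<comment> \<open>Variables in the values of \<open>\<theta>\<close> are unbound there, so
    \<open>\<theta>\<^sub>2\<close> links each such \<open>v\<close> to \<open>\<pi> v\<close>.
    Hence \<open>\<mu>\<close> identifies \<open>v\<close> with \<open>\<pi> v\<close> and the
    renaming disappears.\<close>
  have \<mu>\<theta>: "absorbs \<mu> \<theta>"
    unfolding absorbs_def
  proof
    fix x
    show "app \<mu> (\<theta> x) = \<mu> x"
    proof (cases "x \<in> sdom \<theta>")
      case True
      have "app \<mu> (Var (\<pi> v)) = \<mu> v" if "v \<in> vars (\<theta> x)" for v
        using Var_V[of v] vars_V[OF True] \<mu>(2) that unfolding absorbs_def by (metis subsetD)
      then have "app \<mu> (app (Var \<circ> \<pi>) (\<theta> x)) = app \<mu> (\<theta> x)"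
        unfolding app_app by (intro app_cong) simp
      moreover have "x \<in> V" using True by (simp add: V_def svars_def)
      ultimately show ?thesis using \<pi>(2)[of x] \<mu>(2) by (metis absorbs_def)
    qed (simp add: sdom_def)
  qed

  have "\<exists>m\<in>Subst ar. (\<exists>\<eta>. \<forall>z. m z = app \<eta> (\<theta>\<^sub>1 z)) \<and>
    (\<forall>(x, t)\<in>set bs. m x = app m t) \<and>
    (\<forall>\<tau>. absorbs \<tau> \<theta>\<^sub>1 \<longrightarrow> (\<forall>(x, t)\<in>set bs. \<tau> x = app \<tau> t) \<longrightarrow> absorbs \<tau> m) \<and>
    sharing_groups m W \<subseteq> u_Sh (S \<union> {{x} | x. x \<in> V - U}) (V - U) bs"
  proof (rule u_Sh_correct[OF inf W])
    show "\<theta>\<^sub>1 \<in> Subst ar" using \<theta>(2) by (simp add: ISubst_def)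
    show "\<forall>(x, t)\<in>set bs. wf_trm ar t \<and> x \<in> W \<and> vars t \<subseteq> W"
      using \<theta>(1) by (auto simp: set_bs W_def V_def ISubst_def Subst_def svars_def srng_def)
    show "distinct (map fst bs)"
      using set_bs(2) unfolding distinct_map by (auto simp: set_bs(1) inj_on_def)
    show "\<forall>(x, t)\<in>set bs. \<forall>(y, r)\<in>set bs. x \<notin> vars r"
      using vars_V by (auto simp: set_bs(1))
    show "\<forall>(x, t)\<in>set bs. \<mu> x = app \<mu> t" using bs_iff \<mu>\<theta> by blast
    show "free_in \<theta>\<^sub>1 (V - U) bs"
      using U2 by (auto simp: free_in_def occ_def notin_svars dest: notin_svars_range)
    show "sharing_groups \<theta>\<^sub>1 W \<subseteq> S \<union> {{x} | x. x \<in> V - U}"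
    proof
      fix G assume "G \<in> sharing_groups \<theta>\<^sub>1 W"
      then obtain y where G: "G = occ \<theta>\<^sub>1 y \<inter> W" by (auto simp: sharing_groups_def)
      show "G \<in> S \<union> {{x} | x. x \<in> V - U}"
      proof (cases "y \<in> V - U")
        case True
        then have "occ \<theta>\<^sub>1 y = {y}"
          using U2[OF True] by (auto simp: occ_def notin_svars dest: notin_svars_range)
        then show ?thesis using True G by (auto simp: W_def)
      next
        case False
        then have "z \<notin> occ \<theta>\<^sub>1 y" if "z \<in> V - U" for z
          using notin_svars[OF U2[OF that]] that by (auto simp: occ_def)
        then have "G = occ \<theta>\<^sub>1 y \<inter> U" unfolding G W_def by blast
        then show ?thesis using S by (auto simp: sharing_groups_def)
      qed
    qed
  qed (use \<mu> in auto)
  then obtain m \<eta> where m: "m \<in> Subst ar" "\<And>z. m z = app \<eta> (\<theta>\<^sub>1 z)" "absorbs m \<theta>" "absorbs \<mu> m"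
    "sharing_groups m W \<subseteq> u_Sh (S \<union> {{x} | x. x \<in> V - U}) (V - U) bs"
    unfolding bs_iff using \<mu>(1) \<mu>\<theta> by blast
  \<comment> \<open>An instance of an idempotent substitution absorbs it.\<close>
  have "absorbs \<theta>\<^sub>1 \<theta>\<^sub>1" by (rule ISubst_absorbs) fact
  moreover have "app m (\<theta>\<^sub>1 z) = app \<eta> (app \<theta>\<^sub>1 (\<theta>\<^sub>1 z))" for z
    unfolding app_app by (rule app_cong) (rule m(2))
  ultimately have m\<theta>1: "absorbs m \<theta>\<^sub>1" by (simp add: absorbs_def m(2))

  \<comment> \<open>For the converse, a unifier of \<open>\<theta>\<^sub>1\<close> and
    \<open>\<theta>\<^sub>2\<close> is built that agrees with \<open>m\<close> on \<open>W\<close>: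
    after \<open>\<theta>\<^sub>2\<close>, \<open>\<kappa>\<close> undoes the renaming
    \<open>\<pi>\<close> and then applies \<open>m\<close>.\<close>
  define \<kappa> where "\<kappa> z = (if z \<in> \<pi> ` (V - sdom \<theta>) then m (inv \<pi> z) else m z)" for z
  define \<tau> where "\<tau> z = app \<kappa> (\<theta>\<^sub>2 z)" for z
  have \<kappa>\<pi>: "\<kappa> (\<pi> v) = m v" if "v \<in> V - sdom \<theta>" for v
    using that inv_f_f[OF bij_is_inj[OF \<pi>(1)]] by (simp add: \<kappa>_def)
  have \<tau>V: "\<tau> v = m v" if v: "v \<in> V" for v
  proof (cases "v \<in> sdom \<theta>")
    case True
    have "app \<kappa> (app (Var \<circ> \<pi>) (\<theta> v)) = app m (\<theta> v)"
      unfolding app_app using vars_V[OF True] \<kappa>\<pi> by (intro app_cong) auto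
    then show ?thesis using \<pi>(2)[OF v] m(3) by (simp add: \<tau>_def absorbs_def)
  next
    case False
    then show ?thesis using v \<kappa>\<pi> Var_V by (simp add: \<tau>_def)
  qed
  have \<tau>U: "\<tau> z = m z" if z: "z \<in> U \<union> svars \<theta>\<^sub>1" "z \<notin> V" for z
  proof -
    have z2: "z \<notin> svars \<theta>\<^sub>2" using disj z by (auto simp: V_def)
    \<comment> \<open>If \<open>z\<close> were \<open>\<pi> v\<close>, then
      \<open>\<theta>\<^sub>2\<close> would map \<open>v\<close> to \<open>z\<close>; as
      \<open>z\<close> is foreign to \<open>\<theta>\<^sub>2\<close>, this makes \<open>v\<close>
      equal to \<open>z\<close> and puts \<open>z\<close> into \<open>V\<close>.\<close>
    moreover have "z \<notin> \<pi> ` (V - sdom \<theta>)"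
    proof
      assume "z \<in> \<pi> ` (V - sdom \<theta>)"
      then obtain v where "v \<in> V" "\<theta>\<^sub>2 v = Var z" using Var_V by auto
      then show False using notin_svars_range[OF z2, of v] z(2) by simp
    qed
    ultimately show ?thesis by (simp add: \<tau>_def \<kappa>_def notin_svars)
  qed
  have "\<tau> \<in> Subst ar"
  proof -
    have "sdom \<kappa> \<subseteq> sdom m \<union> \<pi> ` V" by (auto simp: sdom_def \<kappa>_def)
    then have "\<kappa> \<in> Subst ar"
      using m(1) \<open>finite V\<close> finite_subset by (fastforce simp: Subst_def \<kappa>_def)
    then show ?thesis unfolding \<tau>_def using \<theta>2 by (auto intro: Subst_comp simp: ISubst_def)
  qed
  have "absorbs \<tau> \<theta>\<^sub>1"
    using m\<theta>1 by (rule absorbs_cong) (metis \<tau>V \<tau>U UnI2)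
  have "absorbs \<theta>\<^sub>2 \<theta>\<^sub>2" using \<theta>2 by (rule ISubst_absorbs)
  moreover have "app \<tau> (\<theta>\<^sub>2 z) = app \<kappa> (app \<theta>\<^sub>2 (\<theta>\<^sub>2 z))" for z
    unfolding app_app by (rule app_cong) (rule \<tau>_def)
  ultimately have "absorbs \<tau> \<theta>\<^sub>2" by (simp add: absorbs_def \<tau>_def)
  with \<open>\<tau> \<in> Subst ar\<close> \<open>absorbs \<tau> \<theta>\<^sub>1\<close> obtain \<delta> where \<delta>: "\<tau> = app \<delta> \<circ> \<mu>"
    using gen by blast
  \<comment> \<open>\<open>\<mu>\<close> factors through \<open>m\<close> because it absorbs
    \<open>m\<close>, and on \<open>W\<close> \<open>m\<close> factors through \<open>\<mu>\<close>
    because \<open>\<tau>\<close> does.\<close>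
  have "sharing_groups \<mu> W \<subseteq> sharing_groups m W"
  proof (rule sharing_groups_instance[OF inf W])
    show "\<mu> w = app \<mu> (m w)" for w using m(4) by (simp add: absorbs_def)
    show "m w = app \<delta> (\<mu> w)" if "w \<in> W" for w
      using that \<tau>U[of w] \<tau>V[of w] \<delta> by (cases "w \<in> V") (auto simp: W_def)
  qed
  then show ?thesis using m(5) by (simp add: W_def V_def)
qed

section \<open>Passage from representatives to the two domains\<close>

theorem theorem6p11:
  fixes ar :: "'f \<Rightarrow> nat"
    and \<chi> :: "(('f, 'v) subst set, 'v) dom"
    and \<theta> :: "('f, 'v) subst"
    and bs :: "('v \<times> ('f, 'v) trm) list"
  assumes "\<exists>c. ar c = 0" and "\<exists>f. ar f \<ge> 2"
    and "infinite (UNIV :: 'v set)"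
    and "\<chi> \<in> Psub ar" and "\<theta> \<in> ISubst ar"
    and "bs \<in> binding_lists \<theta>"
  shows "alpha_Sh ar (unif_Ps ar \<chi> \<theta>) \<sqsubseteq> unif_Sh (alpha_Sh ar \<chi>) \<theta> bs"
proof (cases \<chi>)
  case (Elt \<Theta> U)
  let ?V = "svars \<theta>"
  let ?S = "\<Union>\<sigma>\<in>{\<sigma> \<in> ISubst ar. ecls ar U \<sigma> \<in> \<Theta>}. sharing_groups \<sigma> U"
  have U: "finite U" "\<Theta> \<subseteq> ISubst ar // esim ar U"
    using assms(4) Elt by (auto simp: Psub_def)
  have "finite ?V"
    using assms(5) by (auto simp: svars_def srng_def ISubst_def Subst_def finite_vars)
  \<comment> \<open>The abstraction ranges over every member \<open>\<sigma>\<close> of a resulting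
    class; each is exchanged for the mgu \<open>\<mu>\<close> that produced the class.\<close>
  have "sharing_groups \<sigma> (U \<union> ?V) \<subseteq> u_Sh (?S \<union> {{x} | x. x \<in> ?V - U}) (?V - U) bs"
    if \<sigma>: "\<sigma> \<in> ISubst ar" and c: "c \<in> \<Theta>" and
      emgu: "is_emgu ar U c ?V (ecls ar ?V \<theta>) (ecls ar (U \<union> ?V) \<sigma>)" for \<sigma> c
  proof -
    obtain \<theta>\<^sub>1 \<theta>\<^sub>2 \<mu> where *: "\<theta>\<^sub>1 \<in> c" "\<theta>\<^sub>2 \<in> ecls ar ?V \<theta>"
      "(U \<union> svars \<theta>\<^sub>1) \<inter> (?V \<union> svars \<theta>\<^sub>2) \<subseteq> U \<inter> ?V" "is_mgu ar \<theta>\<^sub>1 \<theta>\<^sub>2 \<mu>"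
      "ecls ar (U \<union> ?V) \<sigma> = ecls ar (U \<union> ?V) \<mu>"
      using emgu unfolding is_emgu_def by blast
    have "\<mu> \<in> ISubst ar" using *(4) by (simp add: is_mgu_def Let_def)
    then have "(\<sigma>, \<mu>) \<in> esim ar (U \<union> ?V)"
      using *(5) \<sigma> eq_equiv_class_iff[OF equiv_esim] by (fastforce simp: ecls_def)
    then have "sharing_groups \<sigma> (U \<union> ?V) \<subseteq> sharing_groups \<mu> (U \<union> ?V)"
      using \<open>finite ?V\<close> U(1) by (intro sharing_groups_esim assms) auto
    also have "\<dots> \<subseteq> u_Sh (?S \<union> {{x} | x. x \<in> ?V - U}) (?V - U) bs"
    proof (rule sharing_groups_is_mgu[OF assms(3) U(1) assms(5) _ _ *(3,4) assms(6)])
      \<comment> \<open>The representative \<open>\<theta>\<^sub>1\<close> used for the mgu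
        generates \<open>c\<close>, so its groups are among those collected in
        \<open>?S\<close>.\<close>
      have "c \<in> ISubst ar // esim ar U" using c U(2) by blast
      then obtain \<theta>\<^sub>0 where "c = esim ar U `` {\<theta>\<^sub>0}" "(\<theta>\<^sub>0, \<theta>\<^sub>1) \<in> esim ar U"
        using *(1) by (auto simp: quotient_def)
      then have "\<theta>\<^sub>1 \<in> ISubst ar" "ecls ar U \<theta>\<^sub>1 = c"
        using equiv_class_eq[OF equiv_esim, of \<theta>\<^sub>0 \<theta>\<^sub>1 ar U] by (auto simp: ecls_def) (simp add: esim_def)
      then show "\<theta>\<^sub>1 \<in> ISubst ar" "sharing_groups \<theta>\<^sub>1 U \<subseteq> ?S" using c by auto
      show "(\<theta>\<^sub>2, \<theta>) \<in> esim ar ?V" using *(2) by (simp add: ecls_def esim_sym)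
    qed
    finally show ?thesis .
  qed
  then show ?thesis using Elt by (auto simp: Let_def)
qed auto

end
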